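(* Assume $r+s=2$, and let $T=-T_{\mathfrak p}Q|_{\mathfrak p}+T_1Q|_{\mathfrak k_1}+T_2Q|_{\mathfrak k_2}$ with $T_{\mathfrak p},T_1,T_2>0$. Set $$a=nd_2(1-\kappa_2)T_{\mathfrak p},\qquad b=d_1^2(1-\kappa_1)T_1-d_2^2(1-\kappa_2)T_2+2n^2T_{\mathfrak p}-\frac{n^2\kappa_1T_{\mathfrak p}^2}{T_1},$$ $$c=-2nd_2T_2+\frac{2nd_2\kappa_1T_{\mathfrak p}T_2}{T_1}-nd_2\kappa_2T_{\mathfrak p},\qquad d=-\frac{d_2^2\kappa_1T_2^2}{T_1}+\kappa_2d_2^2T_2,$$ $D=18abcd-4b^3d+b^2c^2-4ac^3-27a^2d^2$, $R_t=-\frac{b}{3a}$, and, when $b^2\ne3ac$, $R_d=\frac{9ad-bc}{2(b^2-3ac)}$ and $R_s=\frac{4abc-9a^2d-b^3}{a(b^2-3ac)}$. Then $S|_{\mathcal M_T^0}$ does not attain a global minimum, and: (1) $S|_{\mathcal M_T^0}$ has a saddle point if and only if $D=0$, $b^2=3ac$ and $\frac{d_2T_2}{nT_{\mathfrak p}}<R_t$; (2) $S|_{\mathcal M_T^0}$ attains a global maximum if and only if $D=0$, $b^2\ne3ac$ and $R_s\le\frac{d_2T_2}{nT_{\mathfrak p}}<R_d$; (3) $S|_{\mathcal M_T^0}$ has a local maximum that is not a global maximum if and only if $D=0$, $b^2\ne3ac$ and $\frac{d_2T_2}{nT_{\mathfrak p}}<R_s<R_d$; (4) $S|_{\mathcal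 M_T^0}$ has a local minimum if and only if $D=0$, $b^2\ne3ac$ and $\frac{d_2T_2}{nT_{\mathfrak p}}<R_d<R_s$. Moreover, whenever a critical point of $S|_{\mathcal M_T^0}$ exists, it is unique up to scaling.
   Context: Let $G$ be a connected non-compact simple Lie group with Lie algebra $\mathfrak g$, $K$ a maximal compact subgroup with Lie algebra $\mathfrak k$, $B$ the Killing form of $\mathfrak g$, and $\mathfrak p$ the $B$-orthogonal complement of $\mathfrak k$ in $\mathfrak g$. Let $Q=B|_{\mathfrak p}-B|_{\mathfrak k}$. Write $\mathfrak k=\mathfrak k_1\oplus\cdots\oplus\mathfrak k_{r+s}$, where $\mathfrak k_1,\dots,\mathfrak k_r$ are the simple ideals of $[\mathfrak k,\mathfrak k]$, $\mathfrak k_{r+1}$ is the centre of $\mathfrak k$, and $s=1$ if the centre is nontrivial, $s=0$ otherwise. Let $n=\dim\mathfrak p$, $d_i=\dim\mathfrak k_i$, and define $\kappa_i$ by $B_i=\kappa_iB|_{\mathfrak k_i}$, $B_i$ the Killing form of $\mathfrak k_i$. Left-invariant tensor fields on $G$ are identified with bilinear forms on $\mathfrak g$; $Q|_{\mathfrak u}$ denotes $Q$ restricted to $\mathfrak u$ and extended by zero on its $Q$-orthogonal complement. $\mathcal M_K$ is the set of left-invariant metrics on $G$ naturally reductive with respect to $G\times K$ (acting by $(x,k)y=xyk^{-1}$), which by a theorem of Gordon are exactly the metrics $\beta Q|_{\mathfrak p}+\sum_i\alpha_iQ|_{\mathfrak k_i}$ with $\beta,\alpha_i>0$; it is a manifold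 via these parameters. $S$ is the scalar curvature functional, and $\mathcal M_T^0=\{g\in\mathcal M_K:\mathrm{tr}_gT=0\}$ with the induced manifold structure. A saddle point means a critical point that is neither a local maximum nor a local minimum. *)

theory Defs
  imports "HOL-Analysis.Analysis"
begin

definition ltr :: "('a::euclidean_space \<Rightarrow> 'a) \<Rightarrow> real" where
  "ltr f = (\<Sum>b\<in>Basis. inner (f b) b)"

definition orth_proj :: "('a::euclidean_space \<Rightarrow> 'a \<Rightarrow> real) \<Rightarrow> 'a set \<Rightarrow> 'a \<Rightarrow> 'a" where
  "orth_proj F U x = (THE u. u \<in> U \<and> (\<forall>w\<in>U. F (x - u) w = 0))"

text \<open>F restricted to U and extended by zero on the F-orthogonal complement of U.\<close>
definition restr :: "('a::euclidean_space \<Rightarrow> 'a \<Rightarrow> real) \<Rightarrow> 'a set \<Rightarrow> 'a \<Rightarrow> 'a \<Rightarrow> real" where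
  "restr F U x y = F (orth_proj F U x) (orth_proj F U y)"

text \<open>Trace of an endomorphism f of a subspace U (f is extended by 0 on the orthogonal complement).\<close>
definition trace_on :: "'a::euclidean_space set \<Rightarrow> ('a \<Rightarrow> 'a) \<Rightarrow> real" where
  "trace_on U f = ltr (\<lambda>z. f (orth_proj inner U z))"

definition lie_algebra :: "('a::euclidean_space \<Rightarrow> 'a \<Rightarrow> 'a) \<Rightarrow> bool" where
  "lie_algebra br \<longleftrightarrow> bilinear br \<and> (\<forall>x. br x x = 0) \<and>
     (\<forall>x y z. br x (br y z) + br y (br z x) + br z (br x y) = 0)"

definition la_subalg :: "('a::euclidean_space \<Rightarrow> 'a \<Rightarrow> 'a) \<Rightarrow> 'a set \<Rightarrow> bool" where
  "la_subalg br W \<longleftrightarrow> subspace W \<and> (\<forall>x\<in>W. \<forall>y\<in>W. br x y \<in> W)"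

definition la_ideal :: "('a::euclidean_space \<Rightarrow> 'a \<Rightarrow> 'a) \<Rightarrow> 'a set \<Rightarrow> 'a set \<Rightarrow> bool" where
  "la_ideal br W V \<longleftrightarrow> subspace V \<and> V \<subseteq> W \<and> (\<forall>w\<in>W. \<forall>v\<in>V. br w v \<in> V)"

definition la_simple :: "('a::euclidean_space \<Rightarrow> 'a \<Rightarrow> 'a) \<Rightarrow> 'a set \<Rightarrow> bool" where
  "la_simple br W \<longleftrightarrow> la_subalg br W \<and> (\<exists>x\<in>W. \<exists>y\<in>W. br x y \<noteq> 0) \<and>
     (\<forall>V. la_ideal br W V \<longrightarrow> V = {0} \<or> V = W)"

definition la_derived :: "('a::euclidean_space \<Rightarrow> 'a \<Rightarrow> 'a) \<Rightarrow> 'a set \<Rightarrow> 'a set" where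
  "la_derived br W = span {br x y | x y. x \<in> W \<and> y \<in> W}"

definition la_centre :: "('a::euclidean_space \<Rightarrow> 'a \<Rightarrow> 'a) \<Rightarrow> 'a set \<Rightarrow> 'a set" where
  "la_centre br W = {z \<in> W. \<forall>w\<in>W. br z w = 0}"

definition la_simple_ideals :: "('a::euclidean_space \<Rightarrow> 'a \<Rightarrow> 'a) \<Rightarrow> 'a set \<Rightarrow> 'a set set" where
  "la_simple_ideals br W = {V. la_ideal br (la_derived br W) V \<and> la_simple br V}"

definition killing :: "('a::euclidean_space \<Rightarrow> 'a \<Rightarrow> 'a) \<Rightarrow> 'a \<Rightarrow> 'a \<Rightarrow> real" where
  "killing br x y = ltr (\<lambda>z. br x (br y z))"

definition killing_on :: "('a::euclidean_space \<Rightarrow> 'a \<Rightarrow> 'a) \<Rightarrow> 'a set \<Rightarrow> 'a \<Rightarrow> 'a \<Rightarrow> real" where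
  "killing_on br U x y = trace_on U (\<lambda>z. br x (br y z))"

text \<open>g = k + p is a Cartan decomposition (k = Lie algebra of a maximal compact subgroup,
  p its Killing-orthogonal complement).\<close>
definition cartan_decomp :: "('a::euclidean_space \<Rightarrow> 'a \<Rightarrow> 'a) \<Rightarrow> 'a set \<Rightarrow> 'a set \<Rightarrow> bool" where
  "cartan_decomp br k p \<longleftrightarrow> la_subalg br k \<and> p = {x. \<forall>y\<in>k. killing br x y = 0} \<and>
     (\<forall>x\<in>k. x \<noteq> 0 \<longrightarrow> killing br x x < 0) \<and> (\<forall>x\<in>p. x \<noteq> 0 \<longrightarrow> killing br x x > 0) \<and>
     (\<forall>x\<in>k. \<forall>y\<in>p. br x y \<in> p) \<and> (\<forall>x\<in>p. \<forall>y\<in>p. br x y \<in> k)"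

definition Qform :: "('a::euclidean_space \<Rightarrow> 'a \<Rightarrow> 'a) \<Rightarrow> 'a set \<Rightarrow> 'a set \<Rightarrow> 'a \<Rightarrow> 'a \<Rightarrow> real" where
  "Qform br k p x y = restr (killing br) p x y - restr (killing br) k x y"

text \<open>Levi-Civita connection on left-invariant fields (Koszul formula).\<close>
definition lc :: "('a::euclidean_space \<Rightarrow> 'a \<Rightarrow> 'a) \<Rightarrow> ('a \<Rightarrow> 'a \<Rightarrow> real) \<Rightarrow> 'a \<Rightarrow> 'a \<Rightarrow> 'a" where
  "lc br ip x y = (SOME v. \<forall>z. ip v z = (ip (br x y) z - ip (br y z) x + ip (br z x) y) / 2)"

definition curv :: "('a::euclidean_space \<Rightarrow> 'a \<Rightarrow> 'a) \<Rightarrow> ('a \<Rightarrow> 'a \<Rightarrow> real) \<Rightarrow> 'a \<Rightarrow> 'a \<Rightarrow> 'a \<Rightarrow> 'a" where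
  "curv br ip x y z = lc br ip x (lc br ip y z) - lc br ip y (lc br ip x z) - lc br ip (br x y) z"

definition ric :: "('a::euclidean_space \<Rightarrow> 'a \<Rightarrow> 'a) \<Rightarrow> ('a \<Rightarrow> 'a \<Rightarrow> real) \<Rightarrow> 'a \<Rightarrow> 'a \<Rightarrow> real" where
  "ric br ip y z = ltr (\<lambda>x. curv br ip x y z)"

definition raise :: "('a::euclidean_space \<Rightarrow> 'a \<Rightarrow> real) \<Rightarrow> ('a \<Rightarrow> 'a \<Rightarrow> real) \<Rightarrow> 'a \<Rightarrow> 'a" where
  "raise ip T y = (SOME w. \<forall>z. ip w z = T y z)"

definition metric_trace :: "('a::euclidean_space \<Rightarrow> 'a \<Rightarrow> real) \<Rightarrow> ('a \<Rightarrow> 'a \<Rightarrow> real) \<Rightarrow> real" where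
  "metric_trace ip T = ltr (raise ip T)"

definition scal :: "('a::euclidean_space \<Rightarrow> 'a \<Rightarrow> 'a) \<Rightarrow> ('a \<Rightarrow> 'a \<Rightarrow> real) \<Rightarrow> real" where
  "scal br ip = metric_trace ip (ric br ip)"

definition nr_metric :: "('a::euclidean_space \<Rightarrow> 'a \<Rightarrow> 'a) \<Rightarrow> 'a set \<Rightarrow> 'a set \<Rightarrow> 'a set \<Rightarrow> 'a set
    \<Rightarrow> real \<times> real \<times> real \<Rightarrow> 'a \<Rightarrow> 'a \<Rightarrow> real" where
  "nr_metric br k p k1 k2 m x y =
     fst m * restr (Qform br k p) p x y + fst (snd m) * restr (Qform br k p) k1 x y
     + snd (snd m) * restr (Qform br k p) k2 x y"

definition is_local_max :: "('b::metric_space \<Rightarrow> real) \<Rightarrow> 'b set \<Rightarrow> 'b \<Rightarrow> bool" where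
  "is_local_max f M m \<longleftrightarrow> m \<in> M \<and> (\<exists>e>0. \<forall>x\<in>M. dist x m < e \<longrightarrow> f x \<le> f m)"

definition is_local_min :: "('b::metric_space \<Rightarrow> real) \<Rightarrow> 'b set \<Rightarrow> 'b \<Rightarrow> bool" where
  "is_local_min f M m \<longleftrightarrow> m \<in> M \<and> (\<exists>e>0. \<forall>x\<in>M. dist x m < e \<longrightarrow> f m \<le> f x)"

definition is_global_max :: "('b \<Rightarrow> real) \<Rightarrow> 'b set \<Rightarrow> 'b \<Rightarrow> bool" where
  "is_global_max f M m \<longleftrightarrow> m \<in> M \<and> (\<forall>x\<in>M. f x \<le> f m)"

definition is_global_min :: "('b \<Rightarrow> real) \<Rightarrow> 'b set \<Rightarrow> 'b \<Rightarrow> bool" where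
  "is_global_min f M m \<longleftrightarrow> m \<in> M \<and> (\<forall>x\<in>M. f m \<le> f x)"

definition is_critical :: "('b::real_normed_vector \<Rightarrow> real) \<Rightarrow> 'b set \<Rightarrow> 'b \<Rightarrow> bool" where
  "is_critical f M m \<longleftrightarrow> m \<in> M \<and> f differentiable (at m) \<and>
     (\<forall>\<gamma> v. (\<forall>t. \<gamma> t \<in> M) \<and> \<gamma> 0 = m \<and> (\<gamma> has_vector_derivative v) (at 0)
        \<longrightarrow> ((f \<circ> \<gamma>) has_real_derivative 0) (at 0))"

definition is_saddle :: "('b::real_normed_vector \<Rightarrow> real) \<Rightarrow> 'b set \<Rightarrow> 'b \<Rightarrow> bool" where
  "is_saddle f M m \<longleftrightarrow> is_critical f M m \<and> \<not> is_local_max f M m \<and> \<not> is_local_min f M m"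

end

(* The scalar curvature of a unimodular metric Lie algebra is expressed through structure constants
   c_ijk in an orthonormal frame: S = - sum c_ijk^2 / 4 - sum B(e_i, e_i) / 2.  For a frame adapted
   to g = p + k1 + k2 the squared constants are totally symmetric up to the metric parameters, and
   only the blocks (ki, ki, ki) and (ki, p, p) survive.  They are determined by d_i and kappa_i, so

     S = - n / (2 beta) + sum_i (d_i kappa_i / (4 alpha_i) - d_i (1 - kappa_i) alpha_i / (4 beta^2)).

   The vanishing of the trace makes the set of metrics a cone over the half line r = alpha_2 / beta > r0
   with r0 = d_2 T_2 / (n T_p), on which beta S is a negative multiple of P(r) = a r^3 + b r^2 + c r + d.
   As S is homogeneous of degree -1, every local extremum or critical point is a double root of P, and
   its type is read off from the position of the remaining root. *)
theory Submission
  imports Defs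
begin

text \<open>Stretching a metric divides S by the stretching factor, so at an extremum or a critical
  point S itself must be 0: this gives P(r) = 0, and only then does the variation of r give P'(r) =
  0. Comparing values of S thereby becomes comparing P with 0, and the scale of a metric drops out.
  A cubic with nonzero leading coefficient has at most one double root u, whence uniqueness up to
  scaling; the remaining root v lies to the left of u for a maximum, to the right for a minimum, and
  coincides with u for a saddle. D, R_t, R_d and R_s are the discriminant and the formulas for these
  roots.

  All of this needs a > 0, that is \<kappa>_2 < 1. Here the simplicity of g enters: otherwise k_2
  would commute with p. The other obstacle is the hypothesis r + s = 2, which only lists the simple
  ideals of [k, k] and the centre. That k is the orthogonal sum of the commuting pieces k_1 and k_2
  has to be derived, and the negative definiteness of B on k does this, because the orthogonal
  complement of an ideal is an ideal that splits off.\<close>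

section \<open>Double roots of real cubics\<close>

text \<open>The roots of the cubic add up to \<open>- b / a\<close>, which leaves
  \<open>- b / a - 2 * r\<close> beside the double root.\<close>

lemma double_root_cubic:
  fixes a b c d r w :: real
  assumes "a \<noteq> 0" "a * r^3 + b * r^2 + c * r + d = 0" "3 * a * r^2 + 2 * b * r + c = 0"
  shows "a * w^3 + b * w^2 + c * w + d = a * (w - r)^2 * (w - (- b / a - 2 * r))"
proof -
  define v where "v = - b / a - 2 * r"
  have b: "b = - a * (2 * r + v)"
    using assms(1) by (simp add: v_def field_simps)
  have c: "c = a * (r^2 + 2 * r * v)"
    using assms(3) unfolding b by algebra
  have "d = - a * r^2 * v"
    using assms(2) unfolding b c by algebra
  then have "a * w^3 + b * w^2 + c * w + d = a * (w - r)^2 * (w - v)"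
    unfolding b c by algebra
  then show ?thesis
    by (simp only: v_def)
qed

text \<open>Both sides have the same leading coefficient, so their difference has degree at most 2
  and its values at 0, 1 and -1 determine it.\<close>

lemma cubic_factor_coeffs:
  fixes a b c d u v :: real
  assumes "\<And>w. a * w^3 + b * w^2 + c * w + d = a * (w - u)^2 * (w - v)"
  shows "b = - a * (2 * u + v)" "c = a * (u^2 + 2 * u * v)" "d = - a * u^2 * v"
proof -
  show d: "d = - a * u^2 * v"
    using assms[of 0] by simp
  have 1: "a + b + c + d = a * (1 - u)^2 * (1 - v)"
    using assms[of 1] by simp
  have 2: "- a + b - c + d = a * (- 1 - u)^2 * (- 1 - v)"
    using assms[of "-1"] by simp
  show "b = - a * (2 * u + v)"
    using 1 2 d by algebra
  then show "c = a * (u^2 + 2 * u * v)"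
    using 1 d by algebra
qed

text \<open>Everything follows from \<open>b^2 - 3 * a * c = a^2 * (u - v)^2\<close>, which vanishes
  exactly at a triple root. The last three formulas recover the triple, the double and the simple
  root from the coefficients.\<close>

lemma cubic_factor_invariants:
  fixes a b c d u v :: real
  assumes a: "a \<noteq> 0"
    and fac: "\<And>w. a * w^3 + b * w^2 + c * w + d = a * (w - u)^2 * (w - v)"
  shows "18 * a * b * c * d - 4 * b^3 * d + b^2 * c^2 - 4 * a * c^3 - 27 * a^2 * d^2 = 0"
    and "b^2 = 3 * a * c \<longleftrightarrow> u = v"
    and "u = v \<Longrightarrow> - b / (3 * a) = u"
    and "u \<noteq> v \<Longrightarrow> (9 * a * d - b * c) / (2 * (b^2 - 3 * a * c)) = u"
    and "u \<noteq> v \<Longrightarrow> (4 * a * b * c - 9 * a^2 * d - b^3) / (a * (b^2 - 3 * a * c)) = v"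
proof -
  note co = cubic_factor_coeffs[of a b c d u v, OF fac]
  show "18 * a * b * c * d - 4 * b^3 * d + b^2 * c^2 - 4 * a * c^3 - 27 * a^2 * d^2 = 0"
    unfolding co by algebra
  have q: "b^2 - 3 * a * c = a^2 * (u - v)^2"
    unfolding co by algebra
  have "b^2 = 3 * a * c \<longleftrightarrow> b^2 - 3 * a * c = 0"
    by simp
  then show "b^2 = 3 * a * c \<longleftrightarrow> u = v"
    using a unfolding q by simp
  show "u = v \<Longrightarrow> - b / (3 * a) = u"
    using a unfolding co by (simp add: field_simps)
  assume uv: "u \<noteq> v"
  have "9 * a * d - b * c = 2 * (a^2 * (u - v)^2) * u"
    unfolding co by algebra
  then show "(9 * a * d - b * c) / (2 * (b^2 - 3 * a * c)) = u"
    using a uv unfolding q by simp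
  have "4 * a * b * c - 9 * a^2 * d - b^3 = a * (a^2 * (u - v)^2) * v"
    unfolding co by algebra
  then show "(4 * a * b * c - 9 * a^2 * d - b^3) / (a * (b^2 - 3 * a * c)) = v"
    using a uv unfolding q by simp
qed

lemma cubic_discriminant_zero:
  fixes a b c d :: real
  assumes a: "a \<noteq> 0"
    and D: "18 * a * b * c * d - 4 * b^3 * d + b^2 * c^2 - 4 * a * c^3 - 27 * a^2 * d^2 = 0"
  obtains u v where "\<And>w. a * w^3 + b * w^2 + c * w + d = a * (w - u)^2 * (w - v)"
proof (cases "b^2 = 3 * a * c")
  case True
  \<comment> \<open>The classical relation between the discriminant and the two coefficients of the
    depressed cubic. When the first of these vanishes along with the discriminant, so does the
    second, and the cubic is a perfect cube up to \<open>a\<close>.\<close>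
  have "(2 * b^3 - 9 * a * b * c + 27 * a^2 * d)^2 = 4 * (b^2 - 3 * a * c)^3
      - 27 * a^2 * (18 * a * b * c * d - 4 * b^3 * d + b^2 * c^2 - 4 * a * c^3 - 27 * a^2 * d^2)"
    by algebra
  also have "\<dots> = 0"
    using D True by simp
  finally have z: "2 * b^3 - 9 * a * b * c + 27 * a^2 * d = 0"
    by simp
  define u where "u = - b / (3 * a)"
  have b: "b = - 3 * a * u"
    using a by (simp add: u_def)
  have c: "c = 3 * a * u^2"
    using True a unfolding b by (simp add: power2_eq_square)
  have "27 * a^2 * (d + a * u^3) = 0"
    using z unfolding b c by algebra
  then have "d = - a * u^3"
    using a by simp
  then have "a * w^3 + b * w^2 + c * w + d = a * (w - u)^2 * (w - u)" for w
    unfolding b c by algebra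
  then show ?thesis by (rule that)
next
  case False
  define q where "q = b^2 - 3 * a * c"
  have q: "q \<noteq> 0"
    using False by (simp add: q_def)
  \<comment> \<open>Dividing the cubic by its derivative leaves a linear remainder proportional to
    \<open>2 * q * w - (9 * a * d - b * c)\<close>; its zero is the only candidate for a common
    root.\<close>
  define u where "u = (9 * a * d - b * c) / (2 * q)"
  have uq: "2 * q * u = 9 * a * d - b * c"
    using q by (simp add: u_def)
  \<comment> \<open>After clearing denominators, the derivative at the candidate is a multiple of
    the discriminant.\<close>
  have "4 * q^2 * (3 * a * u^2 + 2 * b * u + c)
      = 3 * a * (2 * q * u)^2 + 4 * b * q * (2 * q * u) + 4 * q^2 * c"
    by algebra
  also have "\<dots> = - 9 * a * (18 * a * b * c * d - 4 * b^3 * d + b^2 * c^2 - 4 * a * c^3 - 27 * a^2 * d^2)"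
    unfolding uq unfolding q_def by algebra
  finally have 2: "3 * a * u^2 + 2 * b * u + c = 0"
    using D q by simp
  have "9 * a * (a * u^3 + b * u^2 + c * u + d)
      = (3 * a * u + b) * (3 * a * u^2 + 2 * b * u + c) - (2 * q * u - (9 * a * d - b * c))"
    unfolding q_def by algebra
  then have 1: "a * u^3 + b * u^2 + c * u + d = 0"
    using 2 uq a by simp
  show ?thesis
    using double_root_cubic[OF a 1 2] by (rule that)
qed

section \<open>The analytic problem in three parameters\<close>

text \<open>Writing a metric of vanishing trace as the point with first coordinate \<open>s\<close> and
  \<open>r\<close> the quotient of the third and the first coordinate, the constraint
  determines the middle coordinate.\<close>

locale trace_zero_cone =
  fixes n d1 d2 \<kappa>1 \<kappa>2 Tp T1 T2 :: real
    and M :: "(real \<times> real \<times> real) set"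
    and Sf :: "real \<times> real \<times> real \<Rightarrow> real"
  assumes n_pos: "n > 0" and d1_pos: "d1 > 0" and d2_pos: "d2 > 0"
    and kappa2_less: "\<kappa>2 < 1"
    and Tp_pos: "Tp > 0" and T1_pos: "T1 > 0" and T2_pos: "T2 > 0"
    and M_iff: "\<And>x y z. (x, y, z) \<in> M \<longleftrightarrow>
          x > 0 \<and> y > 0 \<and> z > 0 \<and> - n * Tp / x + d1 * T1 / y + d2 * T2 / z = 0"
    and Sf_eq: "\<And>x y z. x > 0 \<Longrightarrow> y > 0 \<Longrightarrow> z > 0 \<Longrightarrow>
          Sf (x, y, z) = - n / (2 * x) + (d1 * \<kappa>1 / (4 * y) - d1 * (1 - \<kappa>1) * y / (4 * x^2))
            + (d2 * \<kappa>2 / (4 * z) - d2 * (1 - \<kappa>2) * z / (4 * x^2))"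
begin

definition a where "a = n * d2 * (1 - \<kappa>2) * Tp"
definition b where "b = d1^2 * (1 - \<kappa>1) * T1 - d2^2 * (1 - \<kappa>2) * T2 + 2 * n^2 * Tp
             - n^2 * \<kappa>1 * Tp^2 / T1"
definition c where "c = - 2 * n * d2 * T2 + 2 * n * d2 * \<kappa>1 * Tp * T2 / T1 - n * d2 * \<kappa>2 * Tp"
definition d where "d = \<kappa>2 * d2^2 * T2 - d2^2 * \<kappa>1 * T2^2 / T1"

definition P where "P w = a * w^3 + b * w^2 + c * w + d"
definition P' where "P' w = 3 * a * w^2 + 2 * b * w + c"
text \<open>Multiplying the trace condition by \<open>z = x * r\<close> turns it into
  \<open>L r * y = d1 * T1 * z\<close>, so the sign of \<open>L r\<close> is the sign of the middle
  coordinate.\<close>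

definition L where "L w = n * Tp * w - d2 * T2"
definition r0 where "r0 = d2 * T2 / (n * Tp)"
definition pt where "pt s r = (s, s * d1 * T1 * r / L r, s * r)"

lemma a_pos: "a > 0"
  using n_pos d2_pos kappa2_less Tp_pos by (simp add: a_def)

lemma r0_pos: "r0 > 0"
  using n_pos d2_pos T2_pos Tp_pos by (simp add: r0_def)

lemma L_pos_iff: "L r > 0 \<longleftrightarrow> r > r0"
  using n_pos Tp_pos by (simp add: L_def r0_def pos_divide_less_eq mult_ac)

lemma DERIV_P: "(P has_real_derivative P' w) (at w)"
  unfolding P_def[abs_def] P'_def by (auto intro!: derivative_eq_intros)

text \<open>The right-hand side is the numerator in which the scalar curvature arises over the
  common denominator \<open>4 * s * r * L r\<close>; sorting it by powers of \<open>w\<close> is the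
  origin of \<open>a\<close>, \<open>b\<close>, \<open>c\<close> and \<open>d\<close>.\<close>

lemma P_eq: "P w = 2 * n * w * L w - \<kappa>1 / T1 * (L w)^2 - d2 * \<kappa>2 * L w
      + d1^2 * (1 - \<kappa>1) * T1 * w^2 + d2 * (1 - \<kappa>2) * w^2 * L w"
  unfolding P_def a_def b_def c_def d_def L_def
  by (simp add: divide_inverse power2_eq_square power3_eq_cube algebra_simps)

text \<open>The trace condition can be solved for the middle coordinate, and the solution is
  positive exactly when \<open>L r > 0\<close>. This is where the threshold \<open>r0\<close> comes
  from.\<close>

lemma M_param: "m \<in> M \<longleftrightarrow> (\<exists>s r. s > 0 \<and> r > r0 \<and> m = pt s r)"
proof
  assume "m \<in> M"
  obtain x y z where m: "m = (x, y, z)"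
    by (cases m)
  with \<open>m \<in> M\<close> have xyz: "x > 0" "y > 0" "z > 0"
    and e: "- n * Tp / x + d1 * T1 / y + d2 * T2 / z = 0"
    by (auto simp: M_iff)
  define r where "r = z / x"
  have r: "r > 0" and z: "z = x * r"
    using xyz by (simp_all add: r_def)
  have e': "L r * y = d1 * T1 * z"
    using e xyz unfolding L_def r_def by (simp add: field_simps)
  have "d1 * T1 * z > 0"
    using d1_pos T1_pos xyz by simp
  then have Lr: "L r > 0"
    using e' xyz zero_less_mult_pos2 by metis
  then have "y = x * d1 * T1 * r / L r"
    using e' z by (simp add: field_simps)
  then show "\<exists>s r. s > 0 \<and> r > r0 \<and> m = pt s r"
    using m xyz Lr z unfolding pt_def L_pos_iff by blast
next
  assume "\<exists>s r. s > 0 \<and> r > r0 \<and> m = pt s r"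
  then obtain s r where s: "s > 0" and r: "r > r0" and m: "m = pt s r"
    by blast
  have Lr: "L r > 0" and rp: "r > 0"
    using r r0_pos by (simp_all add: L_pos_iff)
  have "- n * Tp / s + d1 * T1 / (s * d1 * T1 * r / L r) + d2 * T2 / (s * r)
      = (- n * Tp * r + L r + d2 * T2) / (s * r)"
    using s rp Lr d1_pos T1_pos by (simp add: field_simps)
  also have "\<dots> = 0"
    by (simp add: L_def)
  finally show "m \<in> M"
    using s rp Lr d1_pos T1_pos by (simp add: m pt_def M_iff)
qed

lemma pt_in_M: "s > 0 \<Longrightarrow> r > r0 \<Longrightarrow> pt s r \<in> M"
  using M_param by blast

lemma Sf_pt:
  assumes s: "s > 0" and r: "r > r0"
  shows "Sf (pt s r) = - P r / (4 * s * r * L r)"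
proof -
  have Lr: "L r > 0" and rp: "r > 0"
    using r r0_pos by (simp_all add: L_pos_iff)
  have y: "s * d1 * T1 * r / L r > 0"
    using s Lr rp d1_pos T1_pos by simp
  define l where "l = L r"
  have l: "l > 0" using Lr by (simp add: l_def)
  have y': "s * d1 * T1 * r / l > 0"
    using y by (simp add: l_def)
  have 1: "d1 * \<kappa>1 / (4 * (s * d1 * T1 * r / l)) = \<kappa>1 * l / (4 * s * T1 * r)"
    using l s rp d1_pos T1_pos by (simp add: field_simps)
  have 2: "d1 * (1 - \<kappa>1) * (s * d1 * T1 * r / l) / (4 * s^2) = d1^2 * (1 - \<kappa>1) * T1 * r / (4 * s * l)"
    using l s by (simp add: power2_eq_square mult_ac)
  have 3: "d2 * (1 - \<kappa>2) * (s * r) / (4 * s^2) = d2 * (1 - \<kappa>2) * r / (4 * s)"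
    using s by (simp add: power2_eq_square)
  have "Sf (pt s r) = - n / (2 * s) + (\<kappa>1 * l / (4 * s * T1 * r) - d1^2 * (1 - \<kappa>1) * T1 * r / (4 * s * l))
      + (d2 * \<kappa>2 / (4 * (s * r)) - d2 * (1 - \<kappa>2) * r / (4 * s))"
    unfolding pt_def l_def[symmetric]
    by (subst Sf_eq) (use s rp y' 1 2 3 in simp_all)
  also have "\<dots> = - (2 * n * r * l - \<kappa>1 / T1 * l^2 - d2 * \<kappa>2 * l
      + d1^2 * (1 - \<kappa>1) * T1 * r^2 + d2 * (1 - \<kappa>2) * r^2 * l) / (4 * s * r * l)"
  proof -
    have "- n / (2 * s) = - (2 * n * r * l) / (4 * s * r * l)"
      using l s rp by simp
    moreover have "\<kappa>1 * l / (4 * s * T1 * r) = \<kappa>1 / T1 * l^2 / (4 * s * r * l)"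
      using l by (simp add: power2_eq_square)
    moreover have "d1^2 * (1 - \<kappa>1) * T1 * r / (4 * s * l) = d1^2 * (1 - \<kappa>1) * T1 * r^2 / (4 * s * r * l)"
      using rp by (simp add: power2_eq_square)
    moreover have "d2 * \<kappa>2 / (4 * (s * r)) = d2 * \<kappa>2 * l / (4 * s * r * l)"
      using l by simp
    moreover have "d2 * (1 - \<kappa>2) * r / (4 * s) = d2 * (1 - \<kappa>2) * r^2 * l / (4 * s * r * l)"
      using l rp by (simp add: power2_eq_square)
    ultimately show ?thesis
      by (simp only: diff_divide_distrib add_divide_distrib minus_add_distrib minus_diff_eq
          minus_divide_left[symmetric])
  qed
  finally show ?thesis
    unfolding P_eq l_def .
qed

section \<open>Extrema in terms of the sign of the cubic\<close>

text \<open>The sign \<open>\<sigma>\<close> treats maxima and minima simultaneously.\<close>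

lemma scaling_extremum:
  fixes P0 C s :: real
  assumes s: "s > 0" and C: "C > 0" and \<sigma>: "\<sigma> \<noteq> 0"
    and ev: "\<forall>\<^sub>F t in at s. \<sigma> * (- P0 / (4 * t * C)) \<le> \<sigma> * (- P0 / (4 * s * C))"
  shows "P0 = 0"
proof -
  define f where "f t = \<sigma> * (- P0 / (4 * t * C))" for t :: real
  \<comment> \<open>Along a ray the functional is a multiple of \<open>1 / t\<close>, whose
    derivative vanishes nowhere unless the multiple is zero.\<close>
  have D: "(f has_real_derivative \<sigma> * P0 / (4 * s^2 * C)) (at s)"
  proof -
    have f: "f = (\<lambda>t. - (\<sigma> * P0 / (4 * C)) * inverse t)"
      by (auto simp: f_def field_simps)
    show ?thesis
      unfolding f
      by (rule DERIV_cong[OF DERIV_cmult[OF DERIV_inverse]])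
         (use s in \<open>simp_all add: power2_eq_square field_simps\<close>)
  qed
  obtain e where e: "e > 0" "\<And>t. t \<noteq> s \<Longrightarrow> dist t s < e \<Longrightarrow> f t \<le> f s"
    using ev unfolding eventually_at f_def by blast
  have "\<forall>t. \<bar>s - t\<bar> < e \<longrightarrow> f t \<le> f s"
  proof (intro allI impI)
    fix t assume "\<bar>s - t\<bar> < e"
    then show "f t \<le> f s"
      using e(2)[of t] by (cases "t = s") (simp_all add: dist_real_def abs_minus_commute)
  qed
  then have "\<sigma> * P0 / (4 * s^2 * C) = 0"
    using DERIV_local_max[OF D e(1)] by simp
  then show ?thesis
    using s C \<sigma> by simp
qed

lemma continuous_pt:
  assumes "r > r0"
  shows "isCont (\<lambda>t. pt t r) s" "isCont (pt s) r"
proof -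
  have L: "L r \<noteq> 0"
    using assms L_pos_iff[of r] by simp
  then show "isCont (\<lambda>t. pt t r) s"
    unfolding pt_def[abs_def] by (auto intro!: continuous_intros)
  show "isCont (pt s) r"
    using L unfolding pt_def[abs_def] L_def[abs_def] by (auto intro!: continuous_intros)
qed

text \<open>Moving along the ray forces the extremal value to be 0. Since the denominator in
  \<open>Sf_pt\<close> is positive, comparing another value with 0 involves only the sign of
  \<open>P\<close> at its quotient \<open>r\<close>.\<close>

lemma local_extremum_iff:
  assumes s: "s > 0" and r: "r > r0" and \<sigma>: "\<sigma> \<noteq> 0"
  shows "(\<exists>e>0. \<forall>x\<in>M. dist x (pt s r) < e \<longrightarrow> \<sigma> * Sf x \<le> \<sigma> * Sf (pt s r))
     \<longleftrightarrow> P r = 0 \<and> (\<forall>\<^sub>F w in at r. \<sigma> * P w \<ge> 0)" (is "?l \<longleftrightarrow> ?r")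
proof
  assume ?l
  then have nh: "\<forall>\<^sub>F x in nhds (pt s r). x \<in> M \<longrightarrow> \<sigma> * Sf x \<le> \<sigma> * Sf (pt s r)"
    unfolding eventually_nhds_metric by blast
  have Lr: "L r > 0" and rp: "r > 0"
    using r r0_pos by (simp_all add: L_pos_iff)
  have "((\<lambda>t. pt t r) \<longlongrightarrow> pt s r) (at s)"
    using continuous_pt(1)[OF r] by (simp add: isCont_def)
  then have "\<forall>\<^sub>F t in at s. pt t r \<in> M \<longrightarrow> \<sigma> * Sf (pt t r) \<le> \<sigma> * Sf (pt s r)"
    using nh unfolding filterlim_iff by blast
  moreover have "\<forall>\<^sub>F t in at s. t > 0"
    using s by (intro order_tendstoD[OF tendsto_ident_at])
  ultimately have "\<forall>\<^sub>F t in at s. \<sigma> * (- P r / (4 * t * (r * L r))) \<le> \<sigma> * (- P r / (4 * s * (r * L r)))"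
    by eventually_elim (use s r in \<open>simp add: pt_in_M Sf_pt mult_ac\<close>)
  then have P0: "P r = 0"
    using scaling_extremum[of s "r * L r" \<sigma>] s rp Lr \<sigma> by simp
  have "(pt s \<longlongrightarrow> pt s r) (at r)"
    using continuous_pt(2)[OF r] by (simp add: isCont_def)
  then have "\<forall>\<^sub>F w in at r. pt s w \<in> M \<longrightarrow> \<sigma> * Sf (pt s w) \<le> \<sigma> * Sf (pt s r)"
    using nh unfolding filterlim_iff by blast
  moreover have "\<forall>\<^sub>F w in at r. w > r0"
    using r by (intro order_tendstoD[OF tendsto_ident_at])
  ultimately have "\<forall>\<^sub>F w in at r. \<sigma> * P w \<ge> 0"
  proof eventually_elim
    case (elim w)
    then have w: "w > 0" "L w > 0"
      using r0_pos by (simp_all add: L_pos_iff)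
    have "\<sigma> * (- P w / (4 * s * w * L w)) \<le> 0"
      using elim s r P0 by (simp add: pt_in_M Sf_pt)
    then have "0 \<le> \<sigma> * P w / (4 * s * w * L w)"
      by simp
    then show ?case
      using w s by (simp add: zero_le_divide_iff not_le split: if_splits) (smt (verit) mult_pos_pos)
  qed
  then show ?r using P0 by simp
next
  assume ?r
  then have P0: "P r = 0" and ev: "\<forall>\<^sub>F w in at r. \<sigma> * P w \<ge> 0"
    by auto
  have ev': "\<forall>\<^sub>F w in nhds r. \<sigma> * P w \<ge> 0"
    using ev P0 by (simp add: eventually_nhds_conv_at)
  \<comment> \<open>The quotient of the outer coordinates recovers \<open>r\<close> whatever the
    scale, and it is continuous, so metrics near \<open>pt s r\<close> have quotients near
    \<open>r\<close>.\<close>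
  define q :: "real \<times> real \<times> real \<Rightarrow> real" where "q x = snd (snd x) / fst x" for x
  have "isCont q (pt s r)"
    unfolding q_def[abs_def] using s by (auto intro!: continuous_intros simp: pt_def)
  moreover have "q (pt s r) = r"
    using s by (simp add: q_def pt_def)
  ultimately have "(q \<longlongrightarrow> r) (nhds (pt s r))"
    by (metis continuous_at tendsto_at_iff_tendsto_nhds)
  then have "\<forall>\<^sub>F x in nhds (pt s r). \<sigma> * P (q x) \<ge> 0"
    using ev' unfolding filterlim_iff by blast
  then obtain e where e: "e > 0" "\<And>x. dist x (pt s r) < e \<Longrightarrow> \<sigma> * P (q x) \<ge> 0"
    unfolding eventually_nhds_metric by blast
  have "\<sigma> * Sf x \<le> \<sigma> * Sf (pt s r)" if "x \<in> M" "dist x (pt s r) < e" for x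
  proof -
    obtain t w where x: "t > 0" "w > r0" "x = pt t w"
      using \<open>x \<in> M\<close> M_param by blast
    have w: "w > 0" "L w > 0"
      using x r0_pos by (simp_all add: L_pos_iff)
    have "q x = w"
      using x by (simp add: q_def pt_def)
    then have "\<sigma> * P w \<ge> 0"
      using e(2)[OF that(2)] by simp
    then have "\<sigma> * P w / (4 * t * w * L w) \<ge> 0"
      using x w by simp
    then show ?thesis
      using x s r P0 by (simp add: Sf_pt)
  qed
  then show ?l using e(1) by blast
qed

lemma double_root_if_local_extremum:
  assumes "P r = 0" "\<forall>\<^sub>F w in at r. \<sigma> * P w \<ge> 0" "\<sigma> \<noteq> 0"
  shows "P' r = 0"
proof -
  obtain e where e: "e > 0" "\<And>w. w \<noteq> r \<Longrightarrow> dist w r < e \<Longrightarrow> \<sigma> * P w \<ge> 0"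
    using assms(2) unfolding eventually_at by blast
  have "((\<lambda>w. \<sigma> * P w) has_real_derivative \<sigma> * P' r) (at r)"
    by (rule DERIV_cmult[OF DERIV_P])
  moreover have "\<forall>w. \<bar>r - w\<bar> < e \<longrightarrow> \<sigma> * P r \<le> \<sigma> * P w"
  proof (intro allI impI)
    fix w assume "\<bar>r - w\<bar> < e"
    then show "\<sigma> * P r \<le> \<sigma> * P w"
      using e(2)[of w] assms(1) by (cases "w = r") (simp_all add: dist_real_def abs_minus_commute)
  qed
  ultimately have "\<sigma> * P' r = 0"
    using DERIV_local_min[OF _ e(1)] by blast
  then show ?thesis using assms(3) by simp
qed

text \<open>A global maximum is a local one, so its value is 0; it then dominates all metrics
  exactly if no quotient beyond \<open>r0\<close> makes \<open>P\<close> negative.\<close>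

lemma global_max_iff:
  assumes s: "s > 0" and r: "r > r0"
  shows "is_global_max Sf M (pt s r) \<longleftrightarrow> P r = 0 \<and> (\<forall>w>r0. P w \<ge> 0)"
proof
  assume g: "is_global_max Sf M (pt s r)"
  then have "\<exists>e>0. \<forall>x\<in>M. dist x (pt s r) < e \<longrightarrow> 1 * Sf x \<le> 1 * Sf (pt s r)"
    unfolding is_global_max_def by (intro exI[of _ 1]) auto
  then have P0: "P r = 0"
    using local_extremum_iff[OF s r, of 1] by simp
  have "P w \<ge> 0" if w: "w > r0" for w
  proof -
    have w': "w > 0" "L w > 0"
      using w r0_pos by (simp_all add: L_pos_iff)
    have "Sf (pt s w) \<le> Sf (pt s r)"
      using g pt_in_M[OF s w] by (simp add: is_global_max_def)
    then have "0 \<le> P w / (4 * s * w * L w)"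
      using P0 s r w by (simp add: Sf_pt)
    then show ?thesis
      using w' s by (simp add: zero_le_divide_iff not_le) (smt (verit) mult_pos_pos)
  qed
  then show "P r = 0 \<and> (\<forall>w>r0. P w \<ge> 0)" using P0 by blast
next
  assume R: "P r = 0 \<and> (\<forall>w>r0. P w \<ge> 0)"
  have "Sf x \<le> Sf (pt s r)" if "x \<in> M" for x
  proof -
    obtain t w where x: "t > 0" "w > r0" "x = pt t w"
      using \<open>x \<in> M\<close> M_param by blast
    have w: "w > 0" "L w > 0"
      using x r0_pos by (simp_all add: L_pos_iff)
    have "P w / (4 * t * w * L w) \<ge> 0"
      using R x w by simp
    then show ?thesis
      using x s r R by (simp add: Sf_pt)
  qed
  then show "is_global_max Sf M (pt s r)"
    using pt_in_M[OF s r] by (simp add: is_global_max_def)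
qed

lemma P_pos_at_infinity: "\<exists>w>r0. P w > 0"
proof -
  \<comment> \<open>The last summand makes \<open>a * w\<close> exceed the sum of the absolute
    values of the other coefficients, and \<open>w > 1\<close> lets \<open>w^2\<close> dominate the
    lower powers, so the cubic term wins.\<close>
  define w where "w = r0 + 1 + (\<bar>b\<bar> + \<bar>c\<bar> + \<bar>d\<bar>) / a"
  have z: "(\<bar>b\<bar> + \<bar>c\<bar> + \<bar>d\<bar>) / a \<ge> 0"
    using a_pos by simp
  then have w: "w > r0" "w > 1"
    using r0_pos by (simp_all add: w_def)
  have "a * w = a * (r0 + 1) + (\<bar>b\<bar> + \<bar>c\<bar> + \<bar>d\<bar>)"
    using a_pos by (simp add: w_def field_simps)
  then have 1: "a * w > \<bar>b\<bar> + \<bar>c\<bar> + \<bar>d\<bar>"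
    using a_pos r0_pos by simp
  have w2: "w^2 \<ge> w"
    using w by (simp add: power2_eq_square)
  then have w2': "w^2 \<ge> 1"
    using w by linarith
  have "\<bar>b\<bar> * w^2 + \<bar>c\<bar> * w^2 + \<bar>d\<bar> * w^2 < a * w * w^2"
    using mult_strict_right_mono[OF 1, of "w^2"] w2' w by (simp add: distrib_right)
  moreover have "\<bar>c\<bar> * w \<le> \<bar>c\<bar> * w^2" "\<bar>d\<bar> * 1 \<le> \<bar>d\<bar> * w^2"
    using mult_left_mono[OF w2, of "\<bar>c\<bar>"] mult_left_mono[OF w2', of "\<bar>d\<bar>"] by simp_all
  moreover have "- \<bar>b\<bar> * w^2 \<le> b * w^2" "- \<bar>c\<bar> * w \<le> c * w"
    using w mult_right_mono[of "- \<bar>b\<bar>" b "w^2"] mult_right_mono[of "- \<bar>c\<bar>" c w]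
    by (simp_all add: abs_le_D2 minus_le_iff)
  ultimately have "P w > 0"
    unfolding P_def by (simp add: power3_eq_cube power2_eq_square mult.assoc)
  then show ?thesis using w(1) by blast
qed

text \<open>The minimal value would have to be 0, but \<open>P\<close> is positive far out, where
  the scalar curvature is therefore negative.\<close>

lemma no_global_min: "\<not> is_global_min Sf M m"
proof
  assume g: "is_global_min Sf M m"
  then obtain s r where s: "s > 0" and r: "r > r0" and m: "m = pt s r"
    using M_param by (auto simp: is_global_min_def)
  have "\<exists>e>0. \<forall>x\<in>M. dist x (pt s r) < e \<longrightarrow> - 1 * Sf x \<le> - 1 * Sf (pt s r)"
    using g m unfolding is_global_min_def by (intro exI[of _ 1]) auto
  then have P0: "P r = 0"
    using local_extremum_iff[OF s r, of "-1"] by simp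
  obtain w where w: "w > r0" "P w > 0"
    using P_pos_at_infinity by blast
  have w': "w > 0" "L w > 0"
    using w r0_pos by (simp_all add: L_pos_iff)
  have "Sf (pt s r) \<le> Sf (pt s w)"
    using g m pt_in_M[OF s w(1)] by (simp add: is_global_min_def)
  moreover have "P w / (4 * s * w * L w) > 0"
    using w w' s by simp
  ultimately show False
    using P0 s r w by (simp add: Sf_pt)
qed

section \<open>Critical points tested along curves\<close>

lemma Sf_differentiable:
  assumes "x > 0" "y > 0" "z > 0"
  shows "Sf differentiable (at (x, y, z))"
proof -
  define F where "F m = - n / (2 * fst m)
      + (d1 * \<kappa>1 / (4 * fst (snd m)) - d1 * (1 - \<kappa>1) * fst (snd m) / (4 * (fst m)^2))
      + (d2 * \<kappa>2 / (4 * snd (snd m)) - d2 * (1 - \<kappa>2) * snd (snd m) / (4 * (fst m)^2))"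
    for m :: "real \<times> real \<times> real"
  have "fst differentiable (at (x, y, z))" "snd differentiable (at (x, y, z))"
    "(\<lambda>m. fst (snd m)) differentiable (at (x, y, z))"
    "(\<lambda>m. snd (snd m)) differentiable (at (x, y, z))"
    unfolding differentiable_def by (auto intro!: derivative_eq_intros exI)
  then have "F differentiable (at (x, y, z))"
    unfolding F_def[abs_def] using assms
    by (intro derivative_intros) auto
  then obtain F' where F': "(F has_derivative F') (at (x, y, z))"
    by (auto simp: differentiable_def)
  have o: "open ({0<..} \<times> ({0<..} \<times> {0<..}) :: (real \<times> real \<times> real) set)"
    by (intro open_Times open_greaterThan)
  have "(Sf has_derivative F') (at (x, y, z))"
    by (rule has_derivative_transform_within_open[OF F' o])
       (use assms in \<open>auto simp: F_def Sf_eq\<close>)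
  then show ?thesis by (auto simp: differentiable_def)
qed

text \<open>Two test curves suffice for one direction: the ray through the point gives the zero of
  \<open>P\<close>, and varying \<open>r\<close> at a fixed first coordinate gives the zero of
  \<open>P'\<close>. Conversely, along any curve in \<open>M\<close> the functional is a quotient
  whose numerator vanishes at 0 together with its derivative.\<close>

lemma critical_iff:
  assumes s: "s > 0" and r: "r > r0"
  shows "is_critical Sf M (pt s r) \<longleftrightarrow> P r = 0 \<and> P' r = 0"
proof
  have Lr: "L r > 0" and rp: "r > 0"
    using r r0_pos by (simp_all add: L_pos_iff)
  assume cr: "is_critical Sf M (pt s r)"
  \<comment> \<open>The definition of a critical point demands curves that stay in \<open>M\<close>
    for every real time; the exponential keeps the scale positive.\<close>
  define \<gamma> where "\<gamma> t = pt (s * exp t) r" for t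
  have "(\<gamma> has_vector_derivative pt s r) (at 0)"
  proof -
    have "((\<lambda>t. s * exp t) has_real_derivative s) (at 0)"
      "((\<lambda>t. s * exp t * d1 * T1 * r / L r) has_real_derivative s * d1 * T1 * r / L r) (at 0)"
      "((\<lambda>t. s * exp t * r) has_real_derivative s * r) (at 0)"
      using Lr by (auto intro!: derivative_eq_intros)
    then show ?thesis
      unfolding \<gamma>_def[abs_def] pt_def has_real_derivative_iff_has_vector_derivative
      by (intro has_vector_derivative_Pair)
  qed
  moreover have "\<gamma> t \<in> M" for t
    using s r by (simp add: \<gamma>_def pt_in_M)
  moreover have "\<gamma> 0 = pt s r"
    by (simp add: \<gamma>_def)
  ultimately have "((Sf \<circ> \<gamma>) has_real_derivative 0) (at 0)"
    using cr unfolding is_critical_def by blast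
  moreover have "Sf \<circ> \<gamma> = (\<lambda>t. exp (- t) * (- P r / (4 * s * r * L r)))"
    using s r rp Lr by (simp add: fun_eq_iff \<gamma>_def Sf_pt exp_minus field_simps)
  moreover have "((\<lambda>t. exp (- t) * (- P r / (4 * s * r * L r)))
      has_real_derivative - (- P r / (4 * s * r * L r))) (at 0)"
  proof -
    have "((\<lambda>t::real. exp (- t)) has_real_derivative - 1) (at 0)"
      by (auto intro!: derivative_eq_intros)
    from DERIV_cmult_right[OF this] show ?thesis
      by (rule DERIV_cong) simp
  qed
  ultimately have "- (- P r / (4 * s * r * L r)) = 0"
    using DERIV_unique by fastforce
  then have P0: "P r = 0"
    using s rp Lr by simp
  \<comment> \<open>Again an exponential, now keeping the quotient above \<open>r0\<close> for all
    times; its velocity \<open>r - r0\<close> at 0 is nonzero.\<close>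
  define \<rho> where "\<rho> t = r0 + (r - r0) * exp t" for t
  have \<rho>: "\<rho> t > r0" for t
    using r by (simp add: \<rho>_def)
  have \<rho>0: "\<rho> 0 = r" by (simp add: \<rho>_def)
  have D\<rho>: "(\<rho> has_real_derivative (r - r0)) (at 0)"
    unfolding \<rho>_def[abs_def] by (auto intro!: derivative_eq_intros)
  have D\<rho>': "\<exists>D. ((\<lambda>t. s * d1 * T1 * \<rho> t / L (\<rho> t)) has_real_derivative D) (at 0)"
    unfolding L_def
    by (rule exI, (rule derivative_eq_intros refl D\<rho> | use Lr \<rho>0 in \<open>simp add: L_def\<close>)+)
  then obtain D where D: "((\<lambda>t. s * d1 * T1 * \<rho> t / L (\<rho> t)) has_real_derivative D) (at 0)"
    by blast
  have D2: "((\<lambda>t. s * \<rho> t) has_real_derivative s * (r - r0)) (at 0)"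
    by (rule DERIV_cmult[OF D\<rho>])
  define \<delta> where "\<delta> t = pt s (\<rho> t)" for t
  have "(\<delta> has_vector_derivative (0, D, s * (r - r0))) (at 0)"
    unfolding \<delta>_def[abs_def] pt_def
    using D D2 by (auto intro!: has_vector_derivative_Pair simp: has_real_derivative_iff_has_vector_derivative)
  moreover have "\<forall>t. \<delta> t \<in> M" "\<delta> 0 = pt s r"
    using s \<rho> by (simp_all add: \<delta>_def pt_in_M \<rho>0)
  ultimately have "((Sf \<circ> \<delta>) has_real_derivative 0) (at 0)"
    using cr unfolding is_critical_def by blast
  moreover have "Sf \<circ> \<delta> = (\<lambda>t. - P (\<rho> t) / (4 * s * \<rho> t * L (\<rho> t)))"
    using s \<rho> by (auto simp: \<delta>_def Sf_pt)
  ultimately have A: "((\<lambda>t. - P (\<rho> t) / (4 * s * \<rho> t * L (\<rho> t))) has_real_derivative 0) (at 0)"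
    by simp
  have B: "((\<lambda>t. 4 * s * \<rho> t * L (\<rho> t)) has_real_derivative
      (4 * s * (r - r0)) * L r + (n * Tp * (r - r0)) * (4 * s * r)) (at 0)"
    unfolding L_def
    by (rule derivative_eq_intros refl D\<rho> | simp add: \<rho>0)+
  \<comment> \<open>Multiplying back by the denominator keeps the derivative 0, because the quotient
    itself is 0 at time 0. This isolates the derivative of the numerator.\<close>
  have "((\<lambda>t. - P (\<rho> t) / (4 * s * \<rho> t * L (\<rho> t)) * (4 * s * \<rho> t * L (\<rho> t))) has_real_derivative 0) (at 0)"
    by (rule DERIV_cong[OF DERIV_mult[OF A B]]) (simp add: \<rho>0 P0)
  moreover have "\<rho> t \<noteq> 0" "L (\<rho> t) \<noteq> 0" for t
    using \<rho>[of t] r0_pos L_pos_iff[of "\<rho> t"] by auto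
  ultimately have 0: "((\<lambda>t. - P (\<rho> t)) has_real_derivative 0) (at 0)"
    using s by simp
  have "((\<lambda>t. - P (\<rho> t)) has_real_derivative - (P' r * (r - r0))) (at 0)"
    using DERIV_minus[OF DERIV_chain2[OF _ D\<rho>, of P "P' r"]] DERIV_P[of r] \<rho>0 by simp
  then have "P' r * (r - r0) = 0"
    using DERIV_unique[OF 0] by fastforce
  then show "P r = 0 \<and> P' r = 0" using P0 r by simp
next
  assume R: "P r = 0 \<and> P' r = 0"
  have Lr: "L r > 0" and rp: "r > 0"
    using r r0_pos by (simp_all add: L_pos_iff)
  have "Sf differentiable (at (pt s r))"
    unfolding pt_def using Sf_differentiable s Lr rp d1_pos T1_pos by simp
  moreover have "((Sf \<circ> \<gamma>) has_real_derivative 0) (at 0)"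
    if \<gamma>: "\<forall>t. \<gamma> t \<in> M" "\<gamma> 0 = pt s r" and v: "(\<gamma> has_vector_derivative v) (at 0)"
    for \<gamma> :: "real \<Rightarrow> real \<times> real \<times> real" and v
  proof -
    define x where "x t = fst (\<gamma> t)" for t
    define z where "z t = snd (snd (\<gamma> t))" for t
    \<comment> \<open>On \<open>M\<close> the middle coordinate is determined by the other two, so
      the outer components of the curve carry the whole functional.\<close>
    define \<rho> where "\<rho> t = z t / x t" for t
    have Dx: "(x has_real_derivative fst v) (at 0)"
      using has_derivative_fst[OF v[unfolded has_vector_derivative_def]]
      unfolding x_def[abs_def] has_real_derivative_iff_has_vector_derivative has_vector_derivative_def
      by simp
    have Dz: "(z has_real_derivative snd (snd v)) (at 0)"
      using has_derivative_snd[OF has_derivative_snd[OF v[unfolded has_vector_derivative_def]]]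
      unfolding z_def[abs_def] has_real_derivative_iff_has_vector_derivative has_vector_derivative_def
      by simp
    have x0: "x 0 = s" and z0: "z 0 = s * r"
      using \<gamma>(2) by (simp_all add: x_def z_def pt_def)
    have \<rho>0: "\<rho> 0 = r"
      using x0 z0 s by (simp add: \<rho>_def)
    have "\<exists>D. (\<rho> has_real_derivative D) (at 0)"
      unfolding \<rho>_def[abs_def] using DERIV_divide[OF Dz Dx] x0 s by auto
    then obtain D where D: "(\<rho> has_real_derivative D) (at 0)" ..
    have "((\<lambda>t. - P (\<rho> t)) has_real_derivative - (P' r * D)) (at 0)"
      using DERIV_minus[OF DERIV_chain2[OF _ D, of P "P' r"]] DERIV_P[of r] \<rho>0 by simp
    then have N: "((\<lambda>t. - P (\<rho> t)) has_real_derivative 0) (at 0)"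
      using R by simp
    have B: "\<exists>D'. ((\<lambda>t. 4 * x t * \<rho> t * L (\<rho> t)) has_real_derivative D') (at 0)"
      unfolding L_def by (rule exI, (rule derivative_eq_intros refl D Dx)+)
    then obtain D' where D': "((\<lambda>t. 4 * x t * \<rho> t * L (\<rho> t)) has_real_derivative D') (at 0)" ..
    have "((\<lambda>t. - P (\<rho> t) / (4 * x t * \<rho> t * L (\<rho> t))) has_real_derivative 0) (at 0)"
      by (rule DERIV_cong[OF DERIV_divide[OF N D']]) (use R \<rho>0 x0 s rp Lr in auto)
    moreover have "(Sf \<circ> \<gamma>) = (\<lambda>t. - P (\<rho> t) / (4 * x t * \<rho> t * L (\<rho> t)))"
    proof
      fix t
      obtain q w where q: "q > 0" "w > r0" "\<gamma> t = pt q w"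
        using \<gamma>(1) M_param by blast
      then have "x t = q" "\<rho> t = w"
        by (simp_all add: x_def \<rho>_def z_def pt_def)
      then show "(Sf \<circ> \<gamma>) t = - P (\<rho> t) / (4 * x t * \<rho> t * L (\<rho> t))"
        using q by (simp add: Sf_pt)
    qed
    ultimately show ?thesis by simp
  qed
  ultimately show "is_critical Sf M (pt s r)"
    using pt_in_M[OF s r] unfolding is_critical_def by blast
qed

lemma local_max_iff:
  assumes "s > 0" "r > r0"
  shows "is_local_max Sf M (pt s r) \<longleftrightarrow> P r = 0 \<and> (\<forall>\<^sub>F w in at r. P w \<ge> 0)"
  using local_extremum_iff[OF assms, of 1] pt_in_M[OF assms] by (simp add: is_local_max_def)

lemma local_min_iff:
  assumes "s > 0" "r > r0"
  shows "is_local_min Sf M (pt s r) \<longleftrightarrow> P r = 0 \<and> (\<forall>\<^sub>F w in at r. P w \<le> 0)"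
  using local_extremum_iff[OF assms, of "-1"] pt_in_M[OF assms] by (simp add: is_local_min_def)

section \<open>Sign of the factored cubic and classification\<close>

text \<open>The triple root \<open>u = v\<close> is allowed. The three relative positions of
  \<open>u\<close> and \<open>v\<close> separate the types of critical points.\<close>

definition factors where "factors u v \<longleftrightarrow> (\<forall>w. P w = a * (w - u)^2 * (w - v))"

lemma factors_root: "factors u v \<Longrightarrow> P u = 0"
  by (simp add: factors_def)

lemma double_root_factors:
  assumes "P r = 0" "P' r = 0"
  shows "factors r (- b / a - 2 * r)"
  using double_root_cubic[of a r b c d] assms a_pos by (simp add: factors_def P_def P'_def)

text \<open>Near \<open>u\<close> the factor \<open>w - v\<close> decides the sign. If
  \<open>v = u\<close> the cubic changes sign at \<open>u\<close>, so points to the left of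
  \<open>u\<close> refute nonnegativity in that case as well as for \<open>v > u\<close>.\<close>

lemma eventually_P_nonneg:
  assumes "factors u v"
  shows "(\<forall>\<^sub>F w in at u. P w \<ge> 0) \<longleftrightarrow> v < u"
proof
  assume "v < u"
  then have "\<forall>\<^sub>F w in at u. v < w"
    by (intro order_tendstoD[OF tendsto_ident_at])
  then show "\<forall>\<^sub>F w in at u. P w \<ge> 0"
    by eventually_elim (use assms a_pos in \<open>simp add: factors_def\<close>)
next
  assume ev: "\<forall>\<^sub>F w in at u. P w \<ge> 0"
  show "v < u"
  proof (rule ccontr)
    assume nv: "\<not> v < u"
    have "\<forall>\<^sub>F w in at_left u. P w \<ge> 0"
      using ev by (simp add: eventually_at_split)
    moreover have "\<forall>\<^sub>F w in at_left u. w < u"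
      by (simp add: eventually_at_filter)
    ultimately have "\<forall>\<^sub>F w in at_left u. False"
    proof eventually_elim
      case (elim w)
      then have "(w - u)^2 > 0" "w - v < 0"
        using nv by auto
      then have "P w < 0"
        using assms a_pos by (simp add: factors_def mult_less_0_iff)
      then show ?case using elim by simp
    qed
    then show False by simp
  qed
qed

lemma eventually_P_nonpos:
  assumes "factors u v"
  shows "(\<forall>\<^sub>F w in at u. P w \<le> 0) \<longleftrightarrow> u < v"
proof
  assume "u < v"
  then have "\<forall>\<^sub>F w in at u. w < v"
    by (intro order_tendstoD[OF tendsto_ident_at])
  then show "\<forall>\<^sub>F w in at u. P w \<le> 0"
    by eventually_elim (use assms a_pos in \<open>simp add: factors_def mult_le_0_iff\<close>)
next
  assume ev: "\<forall>\<^sub>F w in at u. P w \<le> 0"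
  show "u < v"
  proof (rule ccontr)
    assume nv: "\<not> u < v"
    have "\<forall>\<^sub>F w in at_right u. P w \<le> 0"
      using ev by (simp add: eventually_at_split)
    moreover have "\<forall>\<^sub>F w in at_right u. u < w"
      by (simp add: eventually_at_filter)
    ultimately have "\<forall>\<^sub>F w in at_right u. False"
    proof eventually_elim
      case (elim w)
      then have "(w - u)^2 > 0" "w - v > 0"
        using nv by auto
      then have "P w > 0"
        using assms a_pos by (simp add: factors_def)
      then show ?case using elim by simp
    qed
    then show False by simp
  qed
qed

text \<open>The double root produces no sign change; \<open>P\<close> changes sign only at
  \<open>v\<close>, which must therefore not lie inside the half line.\<close>

lemma P_nonneg_iff:
  assumes "factors u v" "u > r0" "v < u"
  shows "(\<forall>w>r0. P w \<ge> 0) \<longleftrightarrow> v \<le> r0"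
proof
  assume nn: "\<forall>w>r0. P w \<ge> 0"
  show "v \<le> r0"
  proof (rule ccontr)
    assume "\<not> v \<le> r0"
    then obtain w where w: "r0 < w" "w < v"
      using dense[of r0 v] by auto
    then have "(w - u)^2 > 0"
      using assms(3) by simp
    then have "P w < 0"
      using assms(1) a_pos w by (simp add: factors_def mult_less_0_iff)
    then show False using nn w by fastforce
  qed
next
  assume "v \<le> r0"
  then show "\<forall>w>r0. P w \<ge> 0"
    using assms(1) a_pos by (simp add: factors_def)
qed

lemma critical_factors:
  assumes "is_critical Sf M m"
  obtains s u v where "s > 0" "u > r0" "m = pt s u" "factors u v"
proof -
  obtain s r where s: "s > 0" and r: "r > r0" and m: "m = pt s r"
    using assms M_param by (auto simp: is_critical_def)
  then show ?thesis
    using that double_root_factors critical_iff[OF s r] assms by blast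
qed

lemma local_max_factors:
  assumes "is_local_max Sf M m"
  obtains s u v where "s > 0" "u > r0" "m = pt s u" "factors u v" "v < u"
proof -
  obtain s r where s: "s > 0" and r: "r > r0" and m: "m = pt s r"
    using assms M_param by (auto simp: is_local_max_def)
  then have 1: "P r = 0" "\<forall>\<^sub>F w in at r. P w \<ge> 0"
    using local_max_iff[OF s r] assms by auto
  have "P' r = 0"
    by (rule double_root_if_local_extremum[of r 1]) (use 1 in auto)
  then show ?thesis
    using that s r m 1 double_root_factors eventually_P_nonneg by blast
qed

lemma local_min_factors:
  assumes "is_local_min Sf M m"
  obtains s u v where "s > 0" "u > r0" "m = pt s u" "factors u v" "u < v"
proof -
  obtain s r where s: "s > 0" and r: "r > r0" and m: "m = pt s r"
    using assms M_param by (auto simp: is_local_min_def)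
  then have 1: "P r = 0" "\<forall>\<^sub>F w in at r. P w \<le> 0"
    using local_min_iff[OF s r] assms by auto
  have "P' r = 0"
    by (rule double_root_if_local_extremum[of r "-1"]) (use 1 in auto)
  then show ?thesis
    using that s r m 1 double_root_factors eventually_P_nonpos by blast
qed

lemma factors_P':
  assumes "factors u v"
  shows "P' u = 0"
proof -
  have "b = - a * (2 * u + v)" "c = a * (u^2 + 2 * u * v)"
    using cubic_factor_coeffs[of a b c d u v] assms by (simp_all add: factors_def P_def)
  then show ?thesis unfolding P'_def by algebra
qed

text \<open>Every point in question yields a factorization with \<open>u > r0\<close>, and
  \<open>D = 0\<close> yields one without such a bound. The invariants then identify
  \<open>u\<close> with \<open>Rt\<close> or \<open>Rd\<close> and \<open>v\<close> with
  \<open>Rs\<close>, so that each condition becomes a statement about the order of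
  \<open>r0\<close>, \<open>u\<close> and \<open>v\<close>.\<close>

theorem critical_points:
  defines "D \<equiv> 18 * a * b * c * d - 4 * b^3 * d + b^2 * c^2 - 4 * a * c^3 - 27 * a^2 * d^2"
    and "Rt \<equiv> - b / (3 * a)"
    and "Rd \<equiv> (9 * a * d - b * c) / (2 * (b^2 - 3 * a * c))"
    and "Rs \<equiv> (4 * a * b * c - 9 * a^2 * d - b^3) / (a * (b^2 - 3 * a * c))"
  shows "(\<exists>m. is_saddle Sf M m) \<longleftrightarrow> D = 0 \<and> b^2 = 3 * a * c \<and> r0 < Rt"
    and "(\<exists>m. is_global_max Sf M m) \<longleftrightarrow> D = 0 \<and> b^2 \<noteq> 3 * a * c \<and> Rs \<le> r0 \<and> r0 < Rd"
    and "(\<exists>m. is_local_max Sf M m \<and> \<not> is_global_max Sf M m) \<longleftrightarrow>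
           D = 0 \<and> b^2 \<noteq> 3 * a * c \<and> r0 < Rs \<and> Rs < Rd"
    and "(\<exists>m. is_local_min Sf M m) \<longleftrightarrow> D = 0 \<and> b^2 \<noteq> 3 * a * c \<and> r0 < Rd \<and> Rd < Rs"
    and "\<And>m m'. is_critical Sf M m \<Longrightarrow> is_critical Sf M m' \<Longrightarrow> \<exists>t>0. m' = t *\<^sub>R m"
proof -
  have a0: "a \<noteq> 0" using a_pos by simp
  have inv: "D = 0" "b^2 = 3 * a * c \<longleftrightarrow> u = v" "u = v \<Longrightarrow> Rt = u"
      "u \<noteq> v \<Longrightarrow> Rd = u" "u \<noteq> v \<Longrightarrow> Rs = v" if "factors u v" for u v
    using cubic_factor_invariants[of a b c d u v, OF a0] that
    unfolding D_def Rt_def Rd_def Rs_def factors_def P_def by blast+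
  have ex: "\<exists>u v. factors u v" if "D = 0"
    using cubic_discriminant_zero[of a b c d, OF a0 that[unfolded D_def]]
    unfolding factors_def P_def by metis
  have crit: "is_critical Sf M (pt 1 u)" if "factors u v" "u > r0" for u v
    using that critical_iff[of 1 u] factors_root factors_P' by simp
  have lmax: "is_local_max Sf M (pt s u) \<longleftrightarrow> v < u" if "factors u v" "u > r0" "s > 0" for s u v
    using that local_max_iff[of s u] factors_root eventually_P_nonneg by simp
  have lmin: "is_local_min Sf M (pt s u) \<longleftrightarrow> u < v" if "factors u v" "u > r0" "s > 0" for s u v
    using that local_min_iff[of s u] factors_root eventually_P_nonpos by simp
  have gmax: "is_global_max Sf M (pt s u) \<longleftrightarrow> v \<le> r0" if "factors u v" "u > r0" "s > 0" "v < u" for s u v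
    using that global_max_iff[of s u] factors_root P_nonneg_iff by simp
  have gl: "is_local_max Sf M m" if "is_global_max Sf M m" for m
    using that unfolding is_global_max_def is_local_max_def by (auto intro: exI[of _ 1])
  show "(\<exists>m. is_saddle Sf M m) \<longleftrightarrow> D = 0 \<and> b^2 = 3 * a * c \<and> r0 < Rt"
  proof
    assume "\<exists>m. is_saddle Sf M m"
    then obtain m where m: "is_critical Sf M m" "\<not> is_local_max Sf M m" "\<not> is_local_min Sf M m"
      by (auto simp: is_saddle_def)
    obtain s u v where f: "s > 0" "u > r0" "m = pt s u" "factors u v"
      using critical_factors[OF m(1)] .
    have "u = v"
      using m lmax lmin f by force
    then show "D = 0 \<and> b^2 = 3 * a * c \<and> r0 < Rt"
      using inv[OF f(4)] f by simp
  next
    assume R: "D = 0 \<and> b^2 = 3 * a * c \<and> r0 < Rt"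
    then obtain u v where f: "factors u v"
      using ex by blast
    then have uv: "u = v" and u: "u > r0"
      using R inv[OF f] by auto
    then have "is_saddle Sf M (pt 1 u)"
      using f crit lmax[OF f] lmin[OF f] by (simp add: is_saddle_def)
    then show "\<exists>m. is_saddle Sf M m" ..
  qed
  show "(\<exists>m. is_global_max Sf M m) \<longleftrightarrow> D = 0 \<and> b^2 \<noteq> 3 * a * c \<and> Rs \<le> r0 \<and> r0 < Rd"
  proof
    assume "\<exists>m. is_global_max Sf M m"
    then obtain m where m: "is_global_max Sf M m" ..
    obtain s u v where f: "s > 0" "u > r0" "m = pt s u" "factors u v" "v < u"
      using local_max_factors[OF gl[OF m]] .
    then show "D = 0 \<and> b^2 \<noteq> 3 * a * c \<and> Rs \<le> r0 \<and> r0 < Rd"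
      using inv[OF f(4)] gmax m by auto
  next
    assume R: "D = 0 \<and> b^2 \<noteq> 3 * a * c \<and> Rs \<le> r0 \<and> r0 < Rd"
    then obtain u v where f: "factors u v"
      using ex by blast
    then have "v \<le> r0" "r0 < u"
      using R inv[OF f] by auto
    then show "\<exists>m. is_global_max Sf M m"
      using gmax[OF f, of 1] by (intro exI[of _ "pt 1 u"]) simp
  qed
  show "(\<exists>m. is_local_max Sf M m \<and> \<not> is_global_max Sf M m) \<longleftrightarrow>
           D = 0 \<and> b^2 \<noteq> 3 * a * c \<and> r0 < Rs \<and> Rs < Rd"
  proof
    assume "\<exists>m. is_local_max Sf M m \<and> \<not> is_global_max Sf M m"
    then obtain m where m: "is_local_max Sf M m" "\<not> is_global_max Sf M m"
      by blast
    obtain s u v where f: "s > 0" "u > r0" "m = pt s u" "factors u v" "v < u"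
      using local_max_factors[OF m(1)] .
    then show "D = 0 \<and> b^2 \<noteq> 3 * a * c \<and> r0 < Rs \<and> Rs < Rd"
      using inv[OF f(4)] gmax m by auto
  next
    assume R: "D = 0 \<and> b^2 \<noteq> 3 * a * c \<and> r0 < Rs \<and> Rs < Rd"
    then obtain u v where f: "factors u v"
      using ex by blast
    then have "r0 < v" "v < u"
      using R inv[OF f] by auto
    then show "\<exists>m. is_local_max Sf M m \<and> \<not> is_global_max Sf M m"
      using gmax[OF f, of 1] lmax[OF f, of 1] by (intro exI[of _ "pt 1 u"]) auto
  qed
  show "(\<exists>m. is_local_min Sf M m) \<longleftrightarrow> D = 0 \<and> b^2 \<noteq> 3 * a * c \<and> r0 < Rd \<and> Rd < Rs"
  proof
    assume "\<exists>m. is_local_min Sf M m"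
    then obtain m where m: "is_local_min Sf M m" ..
    obtain s u v where f: "s > 0" "u > r0" "m = pt s u" "factors u v" "u < v"
      using local_min_factors[OF m] .
    then show "D = 0 \<and> b^2 \<noteq> 3 * a * c \<and> r0 < Rd \<and> Rd < Rs"
      using inv[OF f(4)] by auto
  next
    assume R: "D = 0 \<and> b^2 \<noteq> 3 * a * c \<and> r0 < Rd \<and> Rd < Rs"
    then obtain u v where f: "factors u v"
      using ex by blast
    then have "r0 < u" "u < v"
      using R inv[OF f] by auto
    then show "\<exists>m. is_local_min Sf M m"
      using lmin[OF f, of 1] by (intro exI[of _ "pt 1 u"]) auto
  qed
  show "\<exists>t>0. m' = t *\<^sub>R m" if m: "is_critical Sf M m" and m': "is_critical Sf M m'" for m m'
  proof -
    obtain s u v where f: "s > 0" "u > r0" "m = pt s u" "factors u v"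
      using critical_factors[OF m] .
    obtain s' u' v' where f': "s' > 0" "u' > r0" "m' = pt s' u'" "factors u' v'"
      using critical_factors[OF m'] .
    \<comment> \<open>Both are given by the same formula in the coefficients: \<open>Rt\<close> when
      \<open>b^2 = 3 * a * c\<close>, and \<open>Rd\<close> otherwise.\<close>
    have "u = u'"
      using inv[OF f(4)] inv[OF f'(4)] by metis
    then have "m' = (s' / s) *\<^sub>R m"
      using f f' by (simp add: pt_def)
    then show ?thesis
      using f(1) f'(1) by (intro exI[of _ "s' / s"]) simp
  qed
qed

end

section \<open>Orthonormal families of bilinear forms\<close>

text \<open>The sign \<open>\<epsilon>\<close> allows for negative definite forms.\<close>

definition orthofam :: "('a::euclidean_space \<Rightarrow> 'a \<Rightarrow> real) \<Rightarrow> real \<Rightarrow> 'i set \<Rightarrow> ('i \<Rightarrow> 'a) \<Rightarrow> bool" where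
  "orthofam F \<epsilon> I v \<longleftrightarrow> bilinear F \<and> finite I \<and> \<epsilon> * \<epsilon> = 1 \<and>
     (\<forall>i\<in>I. \<forall>j\<in>I. F (v i) (v j) = (if i = j then \<epsilon> else 0))"

lemma bilinear_linear: "bilinear f \<Longrightarrow> linear (f x)" "bilinear f \<Longrightarrow> linear (\<lambda>x. f x y)"
  by (simp_all add: bilinear_def)

lemma bilinear_sum_left: "bilinear f \<Longrightarrow> f (\<Sum>i\<in>I. c i *\<^sub>R u i) y = (\<Sum>i\<in>I. c i *\<^sub>R f (u i) y)"
  using linear_sum[OF bilinear_linear(2)[of f y], of "\<lambda>i. c i *\<^sub>R u i" I] by (simp add: bilinear_lmul)

lemma bilinear_sum_right: "bilinear f \<Longrightarrow> f x (\<Sum>i\<in>I. c i *\<^sub>R u i) = (\<Sum>i\<in>I. c i *\<^sub>R f x (u i))"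
  using linear_sum[OF bilinear_linear(1)[of f x], of "\<lambda>i. c i *\<^sub>R u i" I] by (simp add: bilinear_rmul)

text \<open>Both sides are linear in \<open>x\<close> and agree on the family; as
  \<open>\<epsilon>\<close> is its own inverse, it is the normalising factor for either
  sign.\<close>

lemma orthofam_expand:
  assumes fam: "orthofam F \<epsilon> I v" and x: "x \<in> span (v ` I)"
  shows "x = (\<Sum>i\<in>I. (\<epsilon> * F x (v i)) *\<^sub>R v i)"
proof -
  have bil: "bilinear F" and fin: "finite I" and \<epsilon>: "\<epsilon> * \<epsilon> = 1"
    using fam by (simp_all add: orthofam_def)
  define g where "g x = (\<Sum>i\<in>I. (\<epsilon> * F x (v i)) *\<^sub>R v i)" for x
  have "linear g"
    unfolding g_def[abs_def]
    by (intro linear_compose_sum ballI linearI)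
       (simp_all add: bilinear_ladd[OF bil] bilinear_lmul[OF bil] algebra_simps)
  moreover have "id y = g y" if y: "y \<in> v ` I" for y
  proof -
    obtain i where i: "i \<in> I" "y = v i"
      using y by blast
    have "g y = (\<Sum>j\<in>I. if j = i then v i else 0)"
      unfolding g_def using fam i \<epsilon> by (intro sum.cong) (auto simp: orthofam_def)
    then show ?thesis using i fin by simp
  qed
  ultimately have "id x = g x"
    using linear_eq_on_span[OF linear_id] x by blast
  then show ?thesis by (simp add: g_def)
qed

lemma orthofam_parseval:
  assumes fam: "orthofam F \<epsilon> I v" and x: "x \<in> span (v ` I)"
  shows "F x y = (\<Sum>i\<in>I. \<epsilon> * F x (v i) * F (v i) y)"
proof -
  have bil: "bilinear F"
    using fam by (simp add: orthofam_def)
  have "F x y = F (\<Sum>i\<in>I. (\<epsilon> * F x (v i)) *\<^sub>R v i) y"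
    using orthofam_expand[OF fam x] by simp
  then show ?thesis
    by (simp add: bilinear_sum_left[OF bil])
qed

lemma orthofam_independent:
  assumes fam: "orthofam F \<epsilon> E id"
  shows "independent E"
proof -
  have "c e = 0" if "(\<Sum>i\<in>E. c i *\<^sub>R i) = 0" "e \<in> E" for c e
  proof -
    have bil: "bilinear F" and fin: "finite E" and \<epsilon>: "\<epsilon> \<noteq> 0"
      using fam by (auto simp: orthofam_def)
    have "0 = F (\<Sum>i\<in>E. c i *\<^sub>R i) e"
      using that(1) by (simp add: bilinear_lzero[OF bil])
    also have "\<dots> = (\<Sum>i\<in>E. c i * F i e)"
      using bilinear_sum_left[OF bil, of c id E e] by simp
    also have "\<dots> = (\<Sum>i\<in>E. if i = e then c e * \<epsilon> else 0)"
      using fam that(2) by (intro sum.cong) (auto simp: orthofam_def)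
    also have "\<dots> = c e * \<epsilon>"
      using fin that(2) by simp
    finally show ?thesis using \<epsilon> by simp
  qed
  moreover have "finite E"
    using fam by (simp add: orthofam_def)
  ultimately show ?thesis
    using independent_if_scalars_zero[of E] by blast
qed

text \<open>Gram-Schmidt by induction on the dimension: normalise one vector \<open>x\<close> and
  continue in its \<open>F\<close>-complement \<open>V\<close>, on which
  \<open>\<epsilon> * F\<close> is still positive definite.\<close>

lemma exists_orthofam:
  fixes F :: "'a::euclidean_space \<Rightarrow> 'a \<Rightarrow> real"
  assumes bil: "bilinear F" and sym: "\<And>x y. F x y = F y x" and \<epsilon>: "\<epsilon> * \<epsilon> = 1"
    and "subspace U" "\<And>x. x \<in> U \<Longrightarrow> x \<noteq> 0 \<Longrightarrow> \<epsilon> * F x x > 0"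
  obtains E where "orthofam F \<epsilon> E id" "span E = U"
proof -
  have "\<exists>E. orthofam F \<epsilon> E id \<and> span E = U"
    if "subspace U" "\<And>x. x \<in> U \<Longrightarrow> x \<noteq> 0 \<Longrightarrow> \<epsilon> * F x x > 0" for U
    using that
  proof (induction "dim U" arbitrary: U rule: less_induct)
    case less
    show ?case
    proof (cases "U = {0}")
      case True
      then show ?thesis
        using bil \<epsilon> by (intro exI[of _ "{}"]) (simp add: orthofam_def)
    next
      case False
      then obtain y where y: "y \<in> U" "y \<noteq> 0"
        using subspace_0[OF less.prems(1)] by blast
      define x where "x = (1 / sqrt (\<epsilon> * F y y)) *\<^sub>R y"
      have py: "\<epsilon> * F y y > 0"
        using less.prems(2) y by blast
      have xU: "x \<in> U"
        using y less.prems(1) by (simp add: x_def subspace_scale)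
      have "\<epsilon> * F x x = (\<epsilon> * F y y) / (sqrt (\<epsilon> * F y y) * sqrt (\<epsilon> * F y y))"
        by (simp add: x_def bilinear_lmul[OF bil] bilinear_rmul[OF bil])
      also have "\<dots> = 1"
        using py by (metis divide_self_if less_irrefl less_imp_le real_sqrt_mult_self abs_of_pos)
      finally have "\<epsilon> * (\<epsilon> * F x x) = \<epsilon>"
        by simp
      then have xx: "F x x = \<epsilon>"
        using \<epsilon> by (simp add: mult.assoc[symmetric])
      have \<epsilon>0: "\<epsilon> \<noteq> 0"
        using \<epsilon> by auto
      define V where "V = {u \<in> U. F u x = 0}"
      have V: "subspace V"
        using less.prems(1) unfolding V_def
        by (auto simp: subspace_def bilinear_lzero[OF bil] bilinear_ladd[OF bil] bilinear_lmul[OF bil])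
      have "V \<subseteq> U" "x \<notin> V"
        using xx \<epsilon>0 by (auto simp: V_def)
      then have "V \<subset> U"
        using xU by blast
      then have "dim V < dim U"
        using V less.prems(1) by (metis dim_psubset span_eq_iff)
      then obtain E where E: "orthofam F \<epsilon> E id" "span E = V"
        using less.hyps[of V] V less.prems(2) \<open>V \<subseteq> U\<close> by blast
      have EV: "e \<in> V" if "e \<in> E" for e
        using E(2) that span_base by blast
      have "x \<notin> E"
        using EV \<open>x \<notin> V\<close> by blast
      have "orthofam F \<epsilon> (insert x E) id"
        using E(1) xx EV \<open>x \<notin> E\<close> sym unfolding orthofam_def V_def by auto
      moreover have "span (insert x E) = U"
      proof
        show "span (insert x E) \<subseteq> U"
          using xU EV \<open>V \<subseteq> U\<close> less.prems(1) by (intro span_minimal) auto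
        show "U \<subseteq> span (insert x E)"
        proof
          fix u assume u: "u \<in> U"
          have "u - (\<epsilon> * F u x) *\<^sub>R x \<in> V"
            using u xU less.prems(1) xx \<epsilon>
            by (simp add: V_def subspace_diff subspace_scale bilinear_lsub[OF bil] bilinear_lmul[OF bil])
          then have "u - (\<epsilon> * F u x) *\<^sub>R x \<in> span (insert x E)"
            using E(2) span_mono[of E "insert x E"] by blast
          moreover have "(\<epsilon> * F u x) *\<^sub>R x \<in> span (insert x E)"
            by (intro span_scale span_base) simp
          ultimately show "u \<in> span (insert x E)"
            by (metis diff_add_cancel span_add)
        qed
      qed
      ultimately show ?thesis by blast
    qed
  qed
  then show ?thesis using assms that by blast
qed

text \<open>Expanding each family in the other and interchanging the sums shows that the trace does
  not depend on the form. It transfers the Euclidean traces in the definitions to frames adapted to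
  the Killing form or to a metric.\<close>

lemma orthofam_trace_unique:
  fixes F G :: "'a::euclidean_space \<Rightarrow> 'a \<Rightarrow> real"
  assumes F: "orthofam F \<epsilon> I v" "span (v ` I) = U" and G: "orthofam G \<eta> J w" "span (w ` J) = U"
    and f: "linear f" "\<And>x. x \<in> U \<Longrightarrow> f x \<in> U"
  shows "(\<Sum>i\<in>I. \<epsilon> * F (f (v i)) (v i)) = (\<Sum>j\<in>J. \<eta> * G (f (w j)) (w j))"
proof -
  have bF: "bilinear F" and bG: "bilinear G"
    using F G by (simp_all add: orthofam_def)
  have vU: "v i \<in> U" if "i \<in> I" for i
    using F(2) span_superset[of "v ` I"] that by auto
  have wU: "w j \<in> U" if "j \<in> J" for j
    using G(2) span_superset[of "w ` J"] that by auto
  have "(\<Sum>i\<in>I. \<epsilon> * F (f (v i)) (v i)) = (\<Sum>i\<in>I. \<Sum>j\<in>J. \<epsilon> * \<eta> * G (f (v i)) (w j) * F (w j) (v i))"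
  proof (rule sum.cong[OF refl])
    fix i assume "i \<in> I"
    then have "f (v i) = (\<Sum>j\<in>J. (\<eta> * G (f (v i)) (w j)) *\<^sub>R w j)"
      using orthofam_expand[OF G(1)] G(2) f(2) vU by blast
    then have "F (f (v i)) (v i) = (\<Sum>j\<in>J. (\<eta> * G (f (v i)) (w j)) *\<^sub>R F (w j) (v i))"
      using bilinear_sum_left[OF bF] by metis
    then show "\<epsilon> * F (f (v i)) (v i) = (\<Sum>j\<in>J. \<epsilon> * \<eta> * G (f (v i)) (w j) * F (w j) (v i))"
      by (simp add: sum_distrib_left mult_ac)
  qed
  also have "\<dots> = (\<Sum>j\<in>J. \<Sum>i\<in>I. \<epsilon> * \<eta> * G (f (v i)) (w j) * F (w j) (v i))"
    by (rule sum.swap)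
  also have "\<dots> = (\<Sum>j\<in>J. \<eta> * G (f (w j)) (w j))"
  proof (rule sum.cong[OF refl])
    fix j assume "j \<in> J"
    then have "w j = (\<Sum>i\<in>I. (\<epsilon> * F (w j) (v i)) *\<^sub>R v i)"
      using orthofam_expand[OF F(1)] F(2) wU by blast
    then have "f (w j) = f (\<Sum>i\<in>I. (\<epsilon> * F (w j) (v i)) *\<^sub>R v i)"
      by simp
    then have "f (w j) = (\<Sum>i\<in>I. (\<epsilon> * F (w j) (v i)) *\<^sub>R f (v i))"
      using f(1) by (simp add: linear_sum linear_cmul)
    then have "G (f (w j)) (w j) = (\<Sum>i\<in>I. (\<epsilon> * F (w j) (v i)) *\<^sub>R G (f (v i)) (w j))"
      using bilinear_sum_left[OF bG] by metis
    then show "(\<Sum>i\<in>I. \<epsilon> * \<eta> * G (f (v i)) (w j) * F (w j) (v i)) = \<eta> * G (f (w j)) (w j)"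
      by (simp add: sum_distrib_left mult_ac)
  qed
  finally show ?thesis .
qed

lemma bilinear_inner: "bilinear (inner :: 'a::euclidean_space \<Rightarrow> 'a \<Rightarrow> real)"
  by (simp add: bilinear_def linear_iff inner_add_left inner_add_right)

lemma orthofam_Basis: "orthofam inner 1 Basis (id :: 'a::euclidean_space \<Rightarrow> 'a)"
  by (auto simp: orthofam_def bilinear_inner inner_Basis)

lemma ltr_orthofam:
  fixes f :: "'a::euclidean_space \<Rightarrow> 'a"
  assumes "orthofam F \<epsilon> I v" "span (v ` I) = UNIV" "linear f"
  shows "ltr f = (\<Sum>i\<in>I. \<epsilon> * F (f (v i)) (v i))"
  using orthofam_trace_unique[OF assms(1,2) orthofam_Basis _ assms(3)]
  by (simp add: ltr_def)

lemma ltr_commute: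
  fixes f g :: "'a::euclidean_space \<Rightarrow> 'a"
  assumes "linear f" "linear g"
  shows "ltr (\<lambda>x. f (g x)) = ltr (\<lambda>x. g (f x))"
proof -
  have *: "ltr (\<lambda>x. f (g x)) = (\<Sum>b\<in>Basis. \<Sum>c\<in>Basis. inner (g b) c * inner (f c) b)"
    if "linear f" for f g :: "'a \<Rightarrow> 'a"
  proof -
    have "f (g b) = (\<Sum>c\<in>Basis. inner (g b) c *\<^sub>R f c)" for b
    proof -
      have "f (g b) = f (\<Sum>c\<in>Basis. inner (g b) c *\<^sub>R c)"
        by (simp add: euclidean_representation)
      then show ?thesis
        using that by (simp add: linear_sum linear_cmul)
    qed
    then show ?thesis
      by (simp add: ltr_def inner_sum_left)
  qed
  have "ltr (\<lambda>x. f (g x)) = (\<Sum>c\<in>Basis. \<Sum>b\<in>Basis. inner (g b) c * inner (f c) b)"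
    unfolding *[OF assms(1)] by (rule sum.swap)
  also have "\<dots> = ltr (\<lambda>x. g (f x))"
    unfolding *[OF assms(2)] by (simp add: mult.commute)
  finally show ?thesis .
qed

text \<open>Uniqueness in the \<open>THE\<close> holds because a vector of the span is determined by
  its values against the family, even where \<open>F\<close> is indefinite on the whole
  space.\<close>

lemma orth_proj_orthofam:
  assumes fam: "orthofam F \<epsilon> E id"
  shows "orth_proj F (span E) x = (\<Sum>e\<in>E. (\<epsilon> * F x e) *\<^sub>R e)"
proof -
  have bil: "bilinear F" and fin: "finite E" and \<epsilon>: "\<epsilon> * \<epsilon> = 1"
    using fam by (simp_all add: orthofam_def)
  define u where "u = (\<Sum>e\<in>E. (\<epsilon> * F x e) *\<^sub>R e)"
  have uU: "u \<in> span E"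
    unfolding u_def by (intro span_sum span_scale span_base)
  have ue: "F u e = F x e" if "e \<in> E" for e
  proof -
    have "F u e = (\<Sum>i\<in>E. (\<epsilon> * F x i) * F i e)"
      unfolding u_def using bilinear_sum_left[OF bil, of _ id E e] by simp
    also have "\<dots> = (\<Sum>i\<in>E. if i = e then F x e else 0)"
      using fam that \<epsilon> by (intro sum.cong) (auto simp: orthofam_def)
    finally show ?thesis using that fin by simp
  qed
  have "F (x - u) w = 0" if "w \<in> span E" for w
    using that
  proof (induction rule: span_induct_alt)
    case base
    then show ?case by (simp add: bilinear_rzero[OF bil])
  next
    case (step c e y)
    then show ?case
      using ue[of e] by (simp add: bilinear_radd[OF bil] bilinear_rmul[OF bil] bilinear_lsub[OF bil])
  qed
  moreover have "u' = u" if "u' \<in> span E" "\<forall>w\<in>span E. F (x - u') w = 0" for u'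
  proof -
    have "F u' e = F u e" if "e \<in> E" for e
      using \<open>\<forall>w\<in>span E. F (x - u') w = 0\<close> that ue[OF that]
      by (simp add: span_base bilinear_lsub[OF bil])
    then show ?thesis
      using orthofam_expand[OF fam, of u'] orthofam_expand[OF fam, of u] that(1) uU by simp
  qed
  ultimately have "(THE u. u \<in> span E \<and> (\<forall>w\<in>span E. F (x - u) w = 0)) = u"
    using uU by (intro the_equality conjI ballI) (assumption | elim conjE)+
  then show ?thesis
    by (simp add: orth_proj_def u_def)
qed

lemma restr_orthofam:
  assumes fam: "orthofam F \<epsilon> E id"
  shows "restr F (span E) x y = \<epsilon> * (\<Sum>e\<in>E. F x e * F y e)"
proof -
  have bil: "bilinear F" and fin: "finite E" and \<epsilon>: "\<epsilon> * \<epsilon> = 1"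
    using fam by (simp_all add: orthofam_def)
  define b where "b f = \<epsilon> * F y f" for f
  have "restr F (span E) x y = (\<Sum>e\<in>E. (\<epsilon> * F x e) * F e (\<Sum>f\<in>E. b f *\<^sub>R f))"
    unfolding restr_def orth_proj_orthofam[OF fam] b_def[symmetric]
    using bilinear_sum_left[OF bil, of _ id E] by simp
  also have "\<dots> = (\<Sum>e\<in>E. \<Sum>f\<in>E. (\<epsilon> * F x e) * ((\<epsilon> * F y f) * F e f))"
    using bilinear_sum_right[OF bil, of _ b id E] by (simp add: sum_distrib_left b_def)
  also have "\<dots> = (\<Sum>e\<in>E. \<Sum>f\<in>E. if f = e then \<epsilon> * (F x e * F y e) else 0)"
    using fam \<epsilon> by (intro sum.cong refl) (auto simp: orthofam_def)
  also have "\<dots> = \<epsilon> * (\<Sum>e\<in>E. F x e * F y e)"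
    using fin by (simp add: sum_distrib_left)
  finally show ?thesis .
qed

text \<open>In a Euclidean orthonormal basis of the span the auxiliary projection in
  \<open>trace_on\<close> disappears, and the intrinsic trace remains.\<close>

lemma trace_on_orthofam:
  fixes f :: "'a::euclidean_space \<Rightarrow> 'a"
  assumes fam: "orthofam F \<epsilon> E id" and f: "linear f" "\<And>x. x \<in> span E \<Longrightarrow> f x \<in> span E"
  shows "trace_on (span E) f = (\<Sum>e\<in>E. \<epsilon> * F (f e) e)"
proof -
  obtain B where B: "orthofam inner 1 B (id :: 'a \<Rightarrow> 'a)" "span B = span E"
    using exists_orthofam[OF bilinear_inner inner_commute, of 1 "span E"] by auto
  have "trace_on (span E) f = ltr (\<lambda>z. \<Sum>b\<in>B. inner z b *\<^sub>R f b)"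
    unfolding trace_on_def B(2)[symmetric] orth_proj_orthofam[OF B(1)]
    using f(1) by (simp add: linear_sum linear_cmul)
  also have "\<dots> = (\<Sum>c\<in>Basis. \<Sum>b\<in>B. inner c b * inner (f b) c)"
    by (simp add: ltr_def inner_sum_left)
  also have "\<dots> = (\<Sum>b\<in>B. \<Sum>c\<in>Basis. inner c b * inner (f b) c)"
    by (rule sum.swap)
  also have "\<dots> = (\<Sum>b\<in>B. inner (f b) b)"
  proof (rule sum.cong[OF refl])
    fix b
    show "(\<Sum>c\<in>Basis. inner c b * inner (f b) c) = inner (f b) b"
      unfolding euclidean_inner[of "f b" b] by (simp add: inner_commute[of _ b] mult.commute)
  qed
  also have "\<dots> = (\<Sum>e\<in>E. \<epsilon> * F (f e) e)"
    using orthofam_trace_unique[OF B(1) _ fam _ f(1), of "span E"] B(2) f(2) by simp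
  finally show ?thesis .
qed

section \<open>Scalar curvature of a unimodular metric Lie algebra\<close>

lemma linear_ltr: "linear (\<lambda>x. ltr (h x))" if "\<And>z. linear (\<lambda>x. h x z)"
  for h :: "'b::real_vector \<Rightarrow> 'a::euclidean_space \<Rightarrow> 'a"
  unfolding ltr_def
  by (intro linearI) (simp_all add: linear_add[OF that] linear_cmul[OF that] inner_add_left
      sum.distrib sum_distrib_left)

locale lie_alg =
  fixes br :: "'a::euclidean_space \<Rightarrow> 'a \<Rightarrow> 'a"
  assumes lie: "lie_algebra br"
begin

lemma bil_br: "bilinear br"
  using lie by (simp add: lie_algebra_def)

lemma br_self [simp]: "br x x = 0"
  using lie by (simp add: lie_algebra_def)

lemma br_skew: "br x y = - br y x"
proof -
  have "br (x + y) (x + y) = 0"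
    by simp
  then have "br x x + br y x + (br x y + br y y) = 0"
    by (simp only: bilinear_ladd[OF bil_br] bilinear_radd[OF bil_br])
  then show ?thesis
    by (simp add: eq_neg_iff_add_eq_0 add.commute)
qed

end

text \<open>The frame is an indexed family, so that rescaled copies of a fixed basis can serve as
  orthonormal frames of different metrics.\<close>

locale metric_lie_algebra = lie_alg br for br :: "'a::euclidean_space \<Rightarrow> 'a \<Rightarrow> 'a" +
  fixes ip :: "'a \<Rightarrow> 'a \<Rightarrow> real" and I :: "'i set" and v :: "'i \<Rightarrow> 'a"
  assumes unimodular: "\<And>x. ltr (br x) = 0"
    and sym: "\<And>x y. ip x y = ip y x"
    and fam: "orthofam ip 1 I v" and spanning: "span (v ` I) = UNIV"
begin

lemma bil: "bilinear ip"
  using fam by (simp add: orthofam_def)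

lemma expand: "x = (\<Sum>i\<in>I. ip x (v i) *\<^sub>R v i)"
  using orthofam_expand[OF fam, of x] spanning by simp

lemma parseval: "ip x y = (\<Sum>i\<in>I. ip x (v i) * ip y (v i))"
  using orthofam_parseval[OF fam, of x y] spanning by (simp add: sym[of y])

lemma ltr_frame: "linear f \<Longrightarrow> ltr f = (\<Sum>i\<in>I. ip (f (v i)) (v i))"
  using ltr_orthofam[OF fam spanning] by simp

lemma ip_eqI: "(\<And>z. ip x z = ip y z) \<Longrightarrow> x = y"
  using expand[of x] expand[of y] by simp

text \<open>The \<open>SOME\<close> terms in \<open>lc\<close> and \<open>raise\<close> are Riesz
  representatives; expanding in the frame exhibits a witness.\<close>

lemma riesz:
  assumes "linear \<phi>"
  shows "ip (SOME w. \<forall>z. ip w z = \<phi> z) z = \<phi> z"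
proof -
  have "\<forall>z. ip (\<Sum>i\<in>I. \<phi> (v i) *\<^sub>R v i) z = \<phi> z"
  proof
    fix z
    have "\<phi> z = \<phi> (\<Sum>i\<in>I. ip z (v i) *\<^sub>R v i)"
      using expand[of z] by simp
    also have "\<dots> = (\<Sum>i\<in>I. ip z (v i) * \<phi> (v i))"
      using assms by (simp add: linear_sum linear_cmul)
    finally show "ip (\<Sum>i\<in>I. \<phi> (v i) *\<^sub>R v i) z = \<phi> z"
      by (simp add: bilinear_sum_left[OF bil] sym[of z] mult.commute)
  qed
  then have "\<forall>z. ip (SOME w. \<forall>z. ip w z = \<phi> z) z = \<phi> z"
    by (rule someI)
  then show ?thesis by blast
qed

lemma ip_raise: "bilinear T \<Longrightarrow> ip (raise ip T y) z = T y z"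
  unfolding raise_def by (rule riesz) (simp add: bilinear_def)

lemma metric_trace_frame:
  assumes T: "bilinear T"
  shows "metric_trace ip T = (\<Sum>i\<in>I. T (v i) (v i))"
proof -
  have "linear (raise ip T)"
    by (intro linearI ip_eqI)
       (simp_all add: ip_raise[OF T] bilinear_ladd[OF bil] bilinear_lmul[OF bil]
         bilinear_ladd[OF T] bilinear_lmul[OF T])
  then show ?thesis
    unfolding metric_trace_def by (simp add: ltr_frame ip_raise[OF T])
qed

lemma koszul: "ip (lc br ip x y) z = (ip (br x y) z - ip (br y z) x + ip (br z x) y) / 2"
  unfolding lc_def
  by (rule riesz, intro linearI)
     (simp_all add: bilinear_ladd[OF bil] bilinear_lmul[OF bil] bilinear_radd[OF bil]
        bilinear_rmul[OF bil] bilinear_ladd[OF bil_br] bilinear_lmul[OF bil_br]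
        bilinear_radd[OF bil_br] bilinear_rmul[OF bil_br] field_simps)

lemma bil_lc: "bilinear (lc br ip)"
  unfolding bilinear_def
  by (intro conjI allI linearI ip_eqI)
     (simp_all add: koszul bilinear_ladd[OF bil] bilinear_lmul[OF bil] bilinear_radd[OF bil]
        bilinear_rmul[OF bil] bilinear_ladd[OF bil_br] bilinear_lmul[OF bil_br]
        bilinear_radd[OF bil_br] bilinear_rmul[OF bil_br] field_simps)

lemma lc_skew: "ip (lc br ip x y) z = - ip (lc br ip x z) y"
proof -
  have "ip (br y z) x = - ip (br z y) x" "ip (br z x) y = - ip (br x z) y" "ip (br y x) z = - ip (br x y) z"
    by (metis br_skew bilinear_lneg[OF bil])+
  then show ?thesis unfolding koszul by (simp add: field_simps)
qed

lemma linear_curv: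
  "linear (\<lambda>x. curv br ip x y z)" "linear (\<lambda>y. curv br ip x y z)" "linear (\<lambda>z. curv br ip x y z)"
  unfolding curv_def
  by (intro linearI; simp add: bilinear_ladd[OF bil_lc] bilinear_lmul[OF bil_lc] bilinear_radd[OF bil_lc]
        bilinear_rmul[OF bil_lc] bilinear_ladd[OF bil_br] bilinear_lmul[OF bil_br]
        bilinear_radd[OF bil_br] bilinear_rmul[OF bil_br] algebra_simps)+

lemma bil_ric: "bilinear (ric br ip)"
  unfolding bilinear_def ric_def by (auto intro!: linear_ltr linear_curv)

definition C where "C i j k = ip (br (v i) (v j)) (v k)"

lemma C_skew: "C j i k = - C i j k"
  unfolding C_def by (metis br_skew bilinear_lneg[OF bil])

text \<open>By the Koszul formula its inner product with \<open>z\<close> is the trace of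
  \<open>br z\<close>, which is 0 by unimodularity. This removes one of the three curvature terms
  from the scalar curvature.\<close>

lemma sum_lc_diag: "(\<Sum>j\<in>I. lc br ip (v j) (v j)) = 0"
proof (rule ip_eqI)
  fix z
  have "ip (lc br ip (v j) (v j)) z = ip (br z (v j)) (v j)" for j
  proof -
    have "ip (br (v j) z) (v j) = - ip (br z (v j)) (v j)"
      by (metis br_skew bilinear_lneg[OF bil])
    then show ?thesis
      by (simp add: koszul bilinear_lzero[OF bil])
  qed
  then have "ip (\<Sum>j\<in>I. lc br ip (v j) (v j)) z = ltr (br z)"
    by (simp add: linear_sum[OF bilinear_linear(2)[OF bil]] ltr_frame[OF bilinear_linear(1)[OF bil_br]])
  then show "ip (\<Sum>j\<in>I. lc br ip (v j) (v j)) z = ip 0 z"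
    by (simp add: unimodular bilinear_lzero[OF bil])
qed

lemma sum3_rotate:
  fixes h :: "'i \<Rightarrow> 'i \<Rightarrow> 'i \<Rightarrow> real"
  shows "(\<Sum>i\<in>I. \<Sum>j\<in>I. \<Sum>k\<in>I. h k i j) = (\<Sum>i\<in>I. \<Sum>j\<in>I. \<Sum>k\<in>I. h i j k)"
proof -
  have "(\<Sum>i\<in>I. \<Sum>j\<in>I. \<Sum>k\<in>I. h k i j) = (\<Sum>i\<in>I. \<Sum>k\<in>I. \<Sum>j\<in>I. h k i j)"
    by (intro sum.cong refl sum.swap)
  also have "\<dots> = (\<Sum>k\<in>I. \<Sum>i\<in>I. \<Sum>j\<in>I. h k i j)"
    by (rule sum.swap)
  finally show ?thesis .
qed

lemma scal_frame:
  "scal br ip = - (\<Sum>i\<in>I. \<Sum>j\<in>I. \<Sum>k\<in>I. (C i j k)^2) / 4 - (\<Sum>i\<in>I. killing br (v i) (v i)) / 2"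
proof -
  let ?n = "lc br ip"
  define \<Gamma> where "\<Gamma> i j k = ip (?n (v i) (v j)) (v k)" for i j k
  have \<Gamma>: "\<Gamma> i j k = (C i j k - C j k i + C k i j) / 2" for i j k
    by (simp add: \<Gamma>_def C_def koszul)
  have 1: "(\<Sum>j\<in>I. \<Sum>i\<in>I. ip (?n (v i) (?n (v j) (v j))) (v i)) = 0"
  proof -
    have "(\<Sum>i\<in>I. ip (?n (v i) x) (v i)) = 0" for x
    proof -
      have "(\<Sum>i\<in>I. ip (?n (v i) x) (v i)) = - ip (\<Sum>i\<in>I. ?n (v i) (v i)) x"
        by (simp add: linear_sum[OF bilinear_linear(2)[OF bil]] lc_skew[of _ x] sum_negf)
      then show ?thesis
        by (simp add: sum_lc_diag bilinear_lzero[OF bil])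
    qed
    then show ?thesis by simp
  qed
  have 2: "ip (?n (v j) (?n (v i) (v j))) (v i) = - (\<Sum>k\<in>I. \<Gamma> i j k * \<Gamma> j i k)" for i j
    unfolding lc_skew[of "v j" "?n (v i) (v j)"] \<Gamma>_def
    by (subst parseval) (simp add: mult.commute)
  have 3: "ip (?n (br (v i) (v j)) (v j)) (v i) = - (\<Sum>k\<in>I. C i j k * \<Gamma> k i j)" for i j
  proof -
    have "ip (?n (br (v i) (v j)) (v j)) (v i) = ip (?n (\<Sum>k\<in>I. C i j k *\<^sub>R v k) (v j)) (v i)"
      by (simp only: C_def expand[symmetric])
    also have "\<dots> = (\<Sum>k\<in>I. C i j k * ip (?n (v k) (v j)) (v i))"
      by (simp add: bilinear_sum_left[OF bil_lc] bilinear_sum_left[OF bil])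
    also have "\<dots> = - (\<Sum>k\<in>I. C i j k * \<Gamma> k i j)"
      unfolding lc_skew[of _ "v j"] \<Gamma>_def by (simp add: sum_negf)
    finally show ?thesis .
  qed
  have "scal br ip = (\<Sum>j\<in>I. \<Sum>i\<in>I. ip (curv br ip (v i) (v j) (v j)) (v i))"
    unfolding scal_def
    by (simp add: metric_trace_frame[OF bil_ric] ric_def ltr_frame[OF linear_curv(1)])
  also have "\<dots> = (\<Sum>j\<in>I. \<Sum>i\<in>I. ip (?n (v i) (?n (v j) (v j))) (v i))
      + (\<Sum>j\<in>I. \<Sum>i\<in>I. \<Sum>k\<in>I. \<Gamma> i j k * \<Gamma> j i k + C i j k * \<Gamma> k i j)"
    by (simp add: curv_def bilinear_lsub[OF bil] 2 3 sum.distrib)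
  also have "\<dots> = (\<Sum>i\<in>I. \<Sum>j\<in>I. \<Sum>k\<in>I. \<Gamma> i j k * \<Gamma> j i k + C i j k * \<Gamma> k i j)"
    unfolding 1 add_0 by (rule sum.swap)
  also have "\<dots> = (\<Sum>i\<in>I. \<Sum>j\<in>I. \<Sum>k\<in>I. (C k i j)^2 / 4 + (C j k i)^2 / 4 - 3 / 4 * (C i j k)^2
      - C k i j * C j k i / 2 + C i j k * C k i j / 2 + C i j k * C j k i / 2)"
  proof (intro sum.cong refl)
    fix i j k
    \<comment> \<open>Skewness in the first two indices reduces the six orders of the indices to the
      three cyclic ones, which the sums below cannot distinguish.\<close>
    have s: "C j i k = - C i j k" "C i k j = - C k i j" "C k j i = - C j k i"
      by (simp_all only: C_skew[of j i k] C_skew[of i k j] C_skew[of k j i])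
    show "\<Gamma> i j k * \<Gamma> j i k + C i j k * \<Gamma> k i j = (C k i j)^2 / 4 + (C j k i)^2 / 4 - 3 / 4 * (C i j k)^2
      - C k i j * C j k i / 2 + C i j k * C k i j / 2 + C i j k * C j k i / 2"
      unfolding \<Gamma> s by (simp add: power2_eq_square field_simps)
  qed
  also have "\<dots> = (\<Sum>i\<in>I. \<Sum>j\<in>I. \<Sum>k\<in>I. (C k i j)^2) / 4 + (\<Sum>i\<in>I. \<Sum>j\<in>I. \<Sum>k\<in>I. (C j k i)^2) / 4
      - 3 / 4 * (\<Sum>i\<in>I. \<Sum>j\<in>I. \<Sum>k\<in>I. (C i j k)^2)
      - (\<Sum>i\<in>I. \<Sum>j\<in>I. \<Sum>k\<in>I. C k i j * C j k i) / 2
      + (\<Sum>i\<in>I. \<Sum>j\<in>I. \<Sum>k\<in>I. C i j k * C k i j) / 2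
      + (\<Sum>i\<in>I. \<Sum>j\<in>I. \<Sum>k\<in>I. C i j k * C j k i) / 2"
    by (simp only: sum.distrib sum_subtractf sum_distrib_left sum_divide_distrib)
  also have "(\<Sum>i\<in>I. \<Sum>j\<in>I. \<Sum>k\<in>I. (C k i j)^2) = (\<Sum>i\<in>I. \<Sum>j\<in>I. \<Sum>k\<in>I. (C i j k)^2)"
    by (rule sum3_rotate)
  also have "(\<Sum>i\<in>I. \<Sum>j\<in>I. \<Sum>k\<in>I. (C j k i)^2) = (\<Sum>i\<in>I. \<Sum>j\<in>I. \<Sum>k\<in>I. (C i j k)^2)"
    using sum3_rotate[of "\<lambda>i j k. (C j k i)^2"] by simp
  also have "(\<Sum>i\<in>I. \<Sum>j\<in>I. \<Sum>k\<in>I. C k i j * C j k i) = (\<Sum>i\<in>I. \<Sum>j\<in>I. \<Sum>k\<in>I. C i j k * C k i j)"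
    by (rule sum3_rotate)
  also have "(\<Sum>i\<in>I. \<Sum>j\<in>I. \<Sum>k\<in>I. C i j k * C j k i) = (\<Sum>i\<in>I. \<Sum>j\<in>I. \<Sum>k\<in>I. C i j k * C k i j)"
    using sum3_rotate[of "\<lambda>i j k. C i j k * C j k i"] by (simp add: mult.commute)
  finally have S: "scal br ip = - (\<Sum>i\<in>I. \<Sum>j\<in>I. \<Sum>k\<in>I. (C i j k)^2) / 4
      + (\<Sum>i\<in>I. \<Sum>j\<in>I. \<Sum>k\<in>I. C i j k * C k i j) / 2"
    by simp
  \<comment> \<open>The mixed products are what the Killing form produces in the frame, which
    explains the second term of the result.\<close>
  have K: "killing br (v i) (v i) = - (\<Sum>j\<in>I. \<Sum>k\<in>I. C i j k * C k i j)" for i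
  proof -
    have "linear (\<lambda>z. br (v i) (br (v i) z))"
      by (intro linearI) (simp_all add: bilinear_radd[OF bil_br] bilinear_rmul[OF bil_br])
    then have "killing br (v i) (v i) = (\<Sum>j\<in>I. ip (br (v i) (br (v i) (v j))) (v j))"
      by (simp add: killing_def ltr_frame)
    also have "\<dots> = (\<Sum>j\<in>I. ip (br (v i) (\<Sum>k\<in>I. C i j k *\<^sub>R v k)) (v j))"
      by (simp only: C_def expand[symmetric])
    also have "\<dots> = (\<Sum>j\<in>I. \<Sum>k\<in>I. C i j k * C i k j)"
      by (simp add: bilinear_sum_right[OF bil_br] bilinear_sum_left[OF bil] C_def)
    also have "\<dots> = - (\<Sum>j\<in>I. \<Sum>k\<in>I. C i j k * C k i j)"
      unfolding sum_negf[symmetric]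
      by (intro sum.cong refl) (subst C_skew[of i], simp)
    finally show ?thesis .
  qed
  show ?thesis
    unfolding S K by (simp add: sum_negf)
qed

end

section \<open>The Killing form\<close>

lemma ltr_diff: "ltr (\<lambda>x. f x - g x) = ltr f - ltr g"
  by (simp add: ltr_def inner_diff_left sum_subtractf)

context lie_alg
begin

lemma br_jacobi: "br (br x y) z = br x (br y z) - br y (br x z)"
proof -
  have "br x (br y z) + br y (br z x) + br z (br x y) = 0"
    using lie by (simp add: lie_algebra_def)
  moreover have "br y (br z x) = - br y (br x z)"
    by (metis br_skew bilinear_rneg[OF bil_br])
  moreover have "br z (br x y) = - br (br x y) z"
    by (rule br_skew)
  ultimately show ?thesis
    by (simp add: algebra_simps eq_neg_iff_add_eq_0)
qed

lemma linear_ad: "linear (br x)"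
  by (rule bilinear_linear(1)[OF bil_br])

lemma linear_ad_ad: "linear (\<lambda>z. br x (br y z))"
  using linear_compose[OF linear_ad linear_ad] by (simp add: o_def)

abbreviation B where "B \<equiv> killing br"

lemma bil_B: "bilinear B"
  unfolding bilinear_def killing_def
  by (intro conjI allI linear_ltr linearI)
     (simp_all add: bilinear_ladd[OF bil_br] bilinear_lmul[OF bil_br]
       bilinear_radd[OF bil_br] bilinear_rmul[OF bil_br])

lemma B_sym: "B x y = B y x"
  unfolding killing_def by (rule ltr_commute[OF linear_ad linear_ad])

lemma B_invariant: "B (br x y) z = B x (br y z)"
proof -
  have "B (br x y) z = ltr (\<lambda>u. br x (br y (br z u))) - ltr (\<lambda>u. br y (br x (br z u)))"
    by (simp add: killing_def br_jacobi ltr_diff)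
  also have "ltr (\<lambda>u. br y (br x (br z u))) = ltr (\<lambda>u. br x (br z (br y u)))"
    using ltr_commute[OF linear_ad linear_ad_ad, of y x z] .
  also have "ltr (\<lambda>u. br x (br y (br z u))) - ltr (\<lambda>u. br x (br z (br y u))) = B x (br y z)"
    by (simp add: killing_def br_jacobi[of y z] bilinear_rsub[OF bil_br] ltr_diff)
  finally show ?thesis .
qed

lemma B_skew: "B (br x y) z = - B y (br x z)"
  by (metis B_invariant br_skew bilinear_lneg[OF bil_B])

lemmas B_simps = bilinear_ladd[OF bil_B] bilinear_radd[OF bil_B] bilinear_lmul[OF bil_B]
  bilinear_rmul[OF bil_B] bilinear_lsub[OF bil_B] bilinear_rsub[OF bil_B]
  bilinear_lzero[OF bil_B] bilinear_rzero[OF bil_B] bilinear_lneg[OF bil_B] bilinear_rneg[OF bil_B]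

end

section \<open>Scalar curvature on a Cartan decomposition\<close>

locale cartan = lie_alg +
  fixes k p
  assumes cartan: "cartan_decomp br k p"
begin

lemma sub_k: "subspace k"
  using cartan by (simp add: cartan_decomp_def la_subalg_def)

lemma br_kk: "x \<in> k \<Longrightarrow> y \<in> k \<Longrightarrow> br x y \<in> k"
  using cartan by (simp add: cartan_decomp_def la_subalg_def)

lemma p_eq: "p = {x. \<forall>y\<in>k. B x y = 0}"
  using cartan by (simp add: cartan_decomp_def)

lemma sub_p: "subspace p"
  unfolding p_eq by (auto simp: subspace_def B_simps)

lemma B_pk: "x \<in> p \<Longrightarrow> y \<in> k \<Longrightarrow> B x y = 0"
  by (simp add: p_eq)

lemma B_neg: "x \<in> k \<Longrightarrow> x \<noteq> 0 \<Longrightarrow> B x x < 0"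
  using cartan by (simp add: cartan_decomp_def)

lemma B_pos: "x \<in> p \<Longrightarrow> x \<noteq> 0 \<Longrightarrow> B x x > 0"
  using cartan by (simp add: cartan_decomp_def)

lemma br_kp: "x \<in> k \<Longrightarrow> y \<in> p \<Longrightarrow> br x y \<in> p"
  using cartan unfolding cartan_decomp_def by blast

lemma br_pp: "x \<in> p \<Longrightarrow> y \<in> p \<Longrightarrow> br x y \<in> k"
  using cartan unfolding cartan_decomp_def by blast

lemma obtain_k_basis:
  assumes "subspace U" "U \<subseteq> k"
  obtains E where "orthofam B (- 1) E id" "span E = U"
proof (rule exists_orthofam[OF bil_B B_sym, of "- 1" U])
  show "- 1 * B x x > 0" if "x \<in> U" "x \<noteq> 0" for x
    using B_neg[of x] that assms(2) by auto
qed (use assms that in auto)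

text \<open>Definiteness of \<open>B\<close> on \<open>U\<close> provides a projection of every
  vector, also of those outside \<open>k\<close>. With \<open>U = k\<close> it yields the sum of
  \<open>k\<close> and \<open>p\<close>; with ideals it yields complements.\<close>

lemma k_orth_split:
  assumes "subspace U" "U \<subseteq> k"
  obtains u where "u \<in> U" "\<And>w. w \<in> U \<Longrightarrow> B (x - u) w = 0"
proof -
  obtain E where E: "orthofam B (- 1) E id" "span E = U"
    using obtain_k_basis[OF assms] .
  define u where "u = (\<Sum>e\<in>E. (- 1 * B x e) *\<^sub>R e)"
  have "u \<in> U"
    unfolding u_def E(2)[symmetric] by (intro span_sum span_scale span_base)
  moreover have "B (x - u) w = 0" if "w \<in> U" for w
  proof -
    have "B w x = (\<Sum>e\<in>E. - 1 * B w e * B e x)"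
      using orthofam_parseval[OF E(1), of w x] that E(2) by simp
    moreover have "B u w = (\<Sum>e\<in>E. (- 1 * B x e) * B e w)"
      unfolding u_def using bilinear_sum_left[OF bil_B, of "\<lambda>e. - 1 * B x e" id E w]
      by (simp only: id_apply real_scaleR_def)
    moreover have "- 1 * B w e * B e x = (- 1 * B x e) * B e w" for e
      using B_sym[of w e] B_sym[of e x] by simp
    ultimately have "B w x = B u w"
      by simp
    then show ?thesis
      using B_sym[of w x] by (simp add: B_simps)
  qed
  ultimately show ?thesis by (rule that)
qed

end

text \<open>A common interface for the two cases of the theorem, \<open>k2\<close> simple or
  \<open>k2\<close> the centre of \<open>k\<close>; in the latter case \<kappa>2 is 0.\<close>

locale cartan_split = cartan +
  fixes k1 k2 and \<kappa>1 \<kappa>2 :: real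
  assumes sub_k1: "subspace k1" and sub_k2: "subspace k2"
    and k_eq: "k = {x + y |x y. x \<in> k1 \<and> y \<in> k2}"
    and br_k1: "\<And>x y. x \<in> k1 \<Longrightarrow> y \<in> k1 \<Longrightarrow> br x y \<in> k1"
    and br_k2: "\<And>x y. x \<in> k2 \<Longrightarrow> y \<in> k2 \<Longrightarrow> br x y \<in> k2"
    and br_k12: "\<And>x y. x \<in> k1 \<Longrightarrow> y \<in> k2 \<Longrightarrow> br x y = 0"
    and B_k12: "\<And>x y. x \<in> k1 \<Longrightarrow> y \<in> k2 \<Longrightarrow> B x y = 0"
    and p_nonzero: "p \<noteq> {0}" and k1_nonzero: "k1 \<noteq> {0}" and k2_nonzero: "k2 \<noteq> {0}"
    and faithful: "\<And>x. x \<in> k \<Longrightarrow> (\<And>y. y \<in> p \<Longrightarrow> br x y = 0) \<Longrightarrow> x = 0"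
    and kappa1: "\<And>x y. x \<in> k1 \<Longrightarrow> y \<in> k1 \<Longrightarrow> killing_on br k1 x y = \<kappa>1 * B x y"
    and kappa2: "\<And>x y. x \<in> k2 \<Longrightarrow> y \<in> k2 \<Longrightarrow> killing_on br k2 x y = \<kappa>2 * B x y"
begin

lemma k1_sub: "k1 \<subseteq> k"
  using subspace_0[OF sub_k2] unfolding k_eq by force

lemma k2_sub: "k2 \<subseteq> k"
  using subspace_0[OF sub_k1] unfolding k_eq by force

end

locale cartan_basis = cartan_split +
  fixes Ep E1 E2
  assumes Ep: "orthofam B 1 Ep id" "span Ep = p"
    and E1: "orthofam B (- 1) E1 id" "span E1 = k1"
    and E2: "orthofam B (- 1) E2 id" "span E2 = k2"
begin

definition E where "E = Ep \<union> (E1 \<union> E2)"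

lemma in_p: "e \<in> Ep \<Longrightarrow> e \<in> p" and in_k1: "e \<in> E1 \<Longrightarrow> e \<in> k1" and in_k2: "e \<in> E2 \<Longrightarrow> e \<in> k2"
  using Ep(2) E1(2) E2(2) span_base by blast+

lemma in_k: "e \<in> E1 \<Longrightarrow> e \<in> k" "e \<in> E2 \<Longrightarrow> e \<in> k"
  using in_k1 in_k2 k1_sub k2_sub by blast+

lemma B_self: "e \<in> Ep \<Longrightarrow> B e e = 1" "e \<in> E1 \<Longrightarrow> B e e = - 1" "e \<in> E2 \<Longrightarrow> B e e = - 1"
  using Ep(1) E1(1) E2(1) by (simp_all add: orthofam_def)

lemma disjoint: "Ep \<inter> (E1 \<union> E2) = {}" "E1 \<inter> E2 = {}"
proof -
  show "Ep \<inter> (E1 \<union> E2) = {}"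
    using B_self by fastforce
  show "E1 \<inter> E2 = {}"
    using B_self(2) B_k12[OF in_k1 in_k2] by fastforce
qed

lemma fin: "finite Ep" "finite E1" "finite E2" "finite E"
  using Ep(1) E1(1) E2(1) by (simp_all add: orthofam_def E_def)

lemma sum_E: "(\<Sum>e\<in>E. h e) = (\<Sum>e\<in>Ep. h e) + ((\<Sum>e\<in>E1. h e) + (\<Sum>e\<in>E2. h e :: real))"
  unfolding E_def using fin disjoint by (simp add: sum.union_disjoint)

lemma B_cross:
  "e \<in> Ep \<Longrightarrow> f \<in> E1 \<Longrightarrow> B e f = 0" "e \<in> Ep \<Longrightarrow> f \<in> E2 \<Longrightarrow> B e f = 0"
  "e \<in> E1 \<Longrightarrow> f \<in> Ep \<Longrightarrow> B e f = 0" "e \<in> E2 \<Longrightarrow> f \<in> Ep \<Longrightarrow> B e f = 0"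
  "e \<in> E1 \<Longrightarrow> f \<in> E2 \<Longrightarrow> B e f = 0" "e \<in> E2 \<Longrightarrow> f \<in> E1 \<Longrightarrow> B e f = 0"
  using B_pk in_p in_k B_k12 in_k1 in_k2 by (metis B_sym)+

lemma B_E:
  assumes "e \<in> E" "f \<in> E" "e \<noteq> f"
  shows "B e f = 0"
  using assms Ep(1) E1(1) E2(1) B_cross unfolding E_def orthofam_def by auto

lemma B_sq: "e \<in> E \<Longrightarrow> B e e * B e e = 1"
  using B_self unfolding E_def by auto

lemma orthofam_k: "orthofam B (- 1) (E1 \<union> E2) id"
  using E1(1) E2(1) B_cross disjoint(2) unfolding orthofam_def by auto

lemma span_k: "span (E1 \<union> E2) = k"
  unfolding span_Un E1(2) E2(2) k_eq by auto

lemma span_E: "span E = UNIV"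
proof -
  have "x \<in> span E" for x
  proof -
    obtain u where u: "u \<in> k" "\<And>w. w \<in> k \<Longrightarrow> B (x - u) w = 0"
      using k_orth_split[OF sub_k order_refl] by blast
    then have "x - u \<in> p"
      by (simp add: p_eq)
    then have "x - u \<in> span E" "u \<in> span E"
      using u(1) unfolding Ep(2)[symmetric] span_k[symmetric] E_def
      by (meson span_mono sup_ge1 sup_ge2 subsetD)+
    then show ?thesis
      by (metis diff_add_cancel span_add)
  qed
  then show ?thesis by auto
qed

abbreviation Q where "Q \<equiv> Qform br k p"

text \<open>The minus sign of \<open>Q\<close> on \<open>k\<close> cancels the sign with which
  \<open>B\<close> projects there, so both blocks contribute sums of the same shape.\<close>

lemma Q_eq: "Q x y = (\<Sum>e\<in>E. B x e * B y e)"
proof -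
  have "Q x y = restr B (span Ep) x y - restr B (span (E1 \<union> E2)) x y"
    by (simp add: Qform_def Ep(2) span_k)
  also have "\<dots> = (\<Sum>e\<in>E. B x e * B y e)"
    unfolding restr_orthofam[OF Ep(1)] restr_orthofam[OF orthofam_k] sum_E
    using fin disjoint by (simp add: sum.union_disjoint)
  finally show ?thesis .
qed

lemma bil_Q: "bilinear Q"
  unfolding bilinear_def Q_eq
  by (intro conjI allI linear_compose_sum ballI linearI) (simp_all add: B_simps algebra_simps)

lemma Q_E: "e \<in> E \<Longrightarrow> Q x e = B e e * B x e"
proof -
  assume e: "e \<in> E"
  have "Q x e = (\<Sum>f\<in>E. if f = e then B e e * B x e else 0)"
    unfolding Q_eq using B_E[OF e] by (intro sum.cong) auto
  then show ?thesis using e fin by simp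
qed

lemma Q_E_sq: "e \<in> E \<Longrightarrow> (Q x e)^2 = (B x e)^2"
  using B_sq[of e] by (simp add: Q_E power_mult_distrib power2_eq_square)

lemma orthofam_Q: "X \<subseteq> E \<Longrightarrow> orthofam Q 1 X id"
proof -
  assume X: "X \<subseteq> E"
  have "Q e f = (if e = f then 1 else 0)" if "e \<in> X" "f \<in> X" for e f
  proof -
    have "e \<in> E" "f \<in> E"
      using that X by auto
    then show ?thesis
      using B_sq[of f] B_E[of e f] by (auto simp: Q_E)
  qed
  then show ?thesis
    using bil_Q finite_subset[OF X fin(4)] by (simp add: orthofam_def)
qed

lemma E_sub: "Ep \<subseteq> E" "E1 \<subseteq> E" "E2 \<subseteq> E"
  by (auto simp: E_def)

lemma restr_Q:
  "restr Q p x y = (\<Sum>e\<in>Ep. Q x e * Q y e)"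
  "restr Q k1 x y = (\<Sum>e\<in>E1. Q x e * Q y e)"
  "restr Q k2 x y = (\<Sum>e\<in>E2. Q x e * Q y e)"
  using restr_orthofam[OF orthofam_Q[OF E_sub(1)], of x y]
    restr_orthofam[OF orthofam_Q[OF E_sub(2)], of x y]
    restr_orthofam[OF orthofam_Q[OF E_sub(3)], of x y]
  by (simp_all add: Ep(2) E1(2) E2(2))

text \<open>Structure constants with the last index lowered by the invariant form \<open>B\<close>,
  hence totally skew. Lowering by \<open>Q\<close> changes at most their signs, which squares do not
  see.\<close>

definition t where "t e f g = B (br e f) g"

lemma t_skew: "t f e g = - t e f g"
  unfolding t_def by (metis br_skew bilinear_lneg[OF bil_B])

lemma t_rotate: "t f g e = t e f g"
  unfolding t_def by (metis B_invariant B_sym)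

lemma ltr_E: "linear f \<Longrightarrow> ltr f = (\<Sum>e\<in>E. B e e * B (f e) e)"
  using ltr_orthofam[OF orthofam_Q[OF order_refl]] span_E by (simp add: Q_E)

lemma unimodular: "ltr (br x) = 0"
  unfolding ltr_E[OF linear_ad] by (simp add: B_invariant B_simps)

text \<open>Covers both the metrics and the tensor \<open>T\<close>: all of them are diagonal in
  \<open>E\<close>, and the weights may have any sign.\<close>

definition diag_form where "diag_form \<mu> x y = (\<Sum>e\<in>E. \<mu> e * (Q x e * Q y e))"

lemma bil_diag_form: "bilinear (diag_form \<mu>)"
  unfolding bilinear_def diag_form_def
  by (intro conjI allI linear_compose_sum ballI linearI)
     (simp_all add: bilinear_ladd[OF bil_Q] bilinear_lmul[OF bil_Q] algebra_simps)

lemma Q_delta: "e \<in> E \<Longrightarrow> f \<in> E \<Longrightarrow> Q e f = (if e = f then 1 else 0)"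
  using orthofam_Q[OF order_refl] by (simp add: orthofam_def)

lemma diag_form_E: "e \<in> E \<Longrightarrow> diag_form \<mu> x e = \<mu> e * Q x e"
proof -
  assume e: "e \<in> E"
  have "diag_form \<mu> x e = (\<Sum>f\<in>E. if f = e then \<mu> e * Q x e else 0)"
    unfolding diag_form_def using e by (intro sum.cong) (auto simp: Q_delta)
  then show ?thesis using e fin by simp
qed

lemma metric_lie_algebra_diag_form:
  assumes pos: "\<And>e. e \<in> E \<Longrightarrow> \<mu> e > 0"
  shows "metric_lie_algebra br (diag_form \<mu>) E (\<lambda>e. (1 / sqrt (\<mu> e)) *\<^sub>R e)"
proof unfold_locales
  show "ltr (br x) = 0" for x
    by (rule unimodular)
  show "diag_form \<mu> x y = diag_form \<mu> y x" for x y
    by (simp add: diag_form_def mult.commute)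
  show "orthofam (diag_form \<mu>) 1 E (\<lambda>e. (1 / sqrt (\<mu> e)) *\<^sub>R e)"
    unfolding orthofam_def
  proof (intro conjI ballI)
    fix e f assume ef: "e \<in> E" "f \<in> E"
    have "diag_form \<mu> ((1 / sqrt (\<mu> e)) *\<^sub>R e) ((1 / sqrt (\<mu> f)) *\<^sub>R f)
        = (if e = f then \<mu> e / (sqrt (\<mu> e) * sqrt (\<mu> e)) else 0)"
      using ef by (simp add: bilinear_lmul[OF bil_diag_form] bilinear_rmul[OF bil_diag_form]
          diag_form_E Q_delta)
    also have "\<dots> = (if e = f then 1 else 0)"
      using pos[OF ef(1)] by (auto simp: abs_of_pos)
    finally show "diag_form \<mu> ((1 / sqrt (\<mu> e)) *\<^sub>R e) ((1 / sqrt (\<mu> f)) *\<^sub>R f) = (if e = f then 1 else 0)" .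
  qed (use bil_diag_form fin in auto)
  have "e \<in> span ((\<lambda>e. (1 / sqrt (\<mu> e)) *\<^sub>R e) ` E)" if e: "e \<in> E" for e
  proof -
    have "e = sqrt (\<mu> e) *\<^sub>R ((1 / sqrt (\<mu> e)) *\<^sub>R e)"
      using pos[OF e] by simp
    then show ?thesis
      using e by (metis (no_types, lifting) imageI span_base span_scale)
  qed
  then have "span E \<subseteq> span ((\<lambda>e. (1 / sqrt (\<mu> e)) *\<^sub>R e) ` E)"
    by (intro span_minimal) auto
  then show "span ((\<lambda>e. (1 / sqrt (\<mu> e)) *\<^sub>R e) ` E) = UNIV"
    using span_E by auto
qed

lemma metric_trace_diag_form:
  assumes pos: "\<And>e. e \<in> E \<Longrightarrow> \<mu> e > 0"
  shows "metric_trace (diag_form \<mu>) (diag_form \<tau>) = (\<Sum>e\<in>E. \<tau> e / \<mu> e)"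
proof -
  interpret m: metric_lie_algebra br "diag_form \<mu>" E "\<lambda>e. (1 / sqrt (\<mu> e)) *\<^sub>R e"
    by (rule metric_lie_algebra_diag_form[OF pos])
  show ?thesis
    unfolding m.metric_trace_frame[OF bil_diag_form]
  proof (rule sum.cong[OF refl])
    fix e assume e: "e \<in> E"
    have "sqrt (\<mu> e) * sqrt (\<mu> e) = \<mu> e"
      using pos[OF e] by simp
    then show "diag_form \<tau> ((1 / sqrt (\<mu> e)) *\<^sub>R e) ((1 / sqrt (\<mu> e)) *\<^sub>R e) = \<tau> e / \<mu> e"
      using e by (simp add: bilinear_lmul[OF bil_diag_form] bilinear_rmul[OF bil_diag_form]
          diag_form_E Q_delta)
  qed
qed

lemma scal_diag_form:
  assumes pos: "\<And>e. e \<in> E \<Longrightarrow> \<mu> e > 0"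
  shows "scal br (diag_form \<mu>) = - (\<Sum>e\<in>E. \<Sum>f\<in>E. \<Sum>g\<in>E. \<mu> g / (\<mu> e * \<mu> f) * (t e f g)^2) / 4
           - (\<Sum>e\<in>E. B e e / \<mu> e) / 2"
proof -
  interpret m: metric_lie_algebra br "diag_form \<mu>" E "\<lambda>e. (1 / sqrt (\<mu> e)) *\<^sub>R e"
    by (rule metric_lie_algebra_diag_form[OF pos])
  have "(m.C e f g)^2 = \<mu> g / (\<mu> e * \<mu> f) * (t e f g)^2" if "e \<in> E" "f \<in> E" "g \<in> E" for e f g
  proof -
    \<comment> \<open>Lowering with the metric contributes \<open>\<mu> g\<close>, and normalising
      the three vectors contributes the square roots.\<close>
    have "m.C e f g = \<mu> g / (sqrt (\<mu> e) * sqrt (\<mu> f) * sqrt (\<mu> g)) * Q (br e f) g"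
      using that by (simp add: m.C_def bilinear_lmul[OF bil_br] bilinear_rmul[OF bil_br]
          bilinear_lmul[OF bil_diag_form] bilinear_rmul[OF bil_diag_form] diag_form_E)
    then have "(m.C e f g)^2 = (\<mu> g)^2 / (\<mu> e * \<mu> f * \<mu> g) * (Q (br e f) g)^2"
      using pos that by (simp add: power_mult_distrib power_divide less_imp_le)
    then show ?thesis
      using pos[OF that(3)] unfolding Q_E_sq[OF that(3)] t_def by (simp add: power2_eq_square)
  qed
  moreover have "B ((1 / sqrt (\<mu> e)) *\<^sub>R e) ((1 / sqrt (\<mu> e)) *\<^sub>R e) = B e e / \<mu> e" if "e \<in> E" for e
  proof -
    have "sqrt (\<mu> e) * sqrt (\<mu> e) = \<mu> e"
      using pos[OF that] by simp
    then show ?thesis by (simp add: B_simps)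
  qed
  ultimately show ?thesis
    unfolding m.scal_frame by simp
qed

text \<open>The triple symbols [XYZ] of the theory of invariant metrics, symmetric in all three
  blocks.\<close>

definition N where "N X Y Z = (\<Sum>e\<in>X. \<Sum>f\<in>Y. \<Sum>g\<in>Z. (t e f g)^2)"

lemma N_swap: "N Y X Z = N X Y Z"
proof -
  have "N Y X Z = (\<Sum>e\<in>X. \<Sum>f\<in>Y. \<Sum>g\<in>Z. (t f e g)^2)"
    unfolding N_def by (rule sum.swap)
  then show ?thesis
    unfolding N_def by (metis (no_types, lifting) power2_minus sum.cong t_skew)
qed

lemma N_rotate: "N Y Z X = N X Y Z"
proof -
  have "N Y Z X = (\<Sum>f\<in>Y. \<Sum>e\<in>X. \<Sum>g\<in>Z. (t f g e)^2)"
    unfolding N_def by (intro sum.cong refl sum.swap)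
  also have "\<dots> = (\<Sum>e\<in>X. \<Sum>f\<in>Y. \<Sum>g\<in>Z. (t f g e)^2)"
    by (rule sum.swap)
  finally show ?thesis
    unfolding N_def by (simp only: t_rotate)
qed

lemma N_zeroI: "(\<And>e f g. e \<in> X \<Longrightarrow> f \<in> Y \<Longrightarrow> g \<in> Z \<Longrightarrow> t e f g = 0) \<Longrightarrow> N X Y Z = 0"
  by (simp add: N_def)

text \<open>\<open>k1\<close> and \<open>k2\<close> are commuting orthogonal subalgebras of
  \<open>k\<close>, and brackets of two elements of \<open>p\<close> fall into \<open>k\<close>;
  each vanishing symbol contradicts one of these facts.\<close>

lemma N_zero: "N E1 E1 E2 = 0" "N E1 E1 Ep = 0" "N E2 E2 E1 = 0" "N E2 E2 Ep = 0"
  "N E1 E2 Ep = 0" "N Ep Ep Ep = 0"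
proof -
  show "N E1 E1 E2 = 0"
    by (rule N_zeroI) (simp add: t_def B_k12 br_k1 in_k1 in_k2)
  show "N E1 E1 Ep = 0"
    by (rule N_zeroI) (metis t_def B_pk B_sym br_kk in_k(1) in_p)
  show "N E2 E2 E1 = 0"
    by (rule N_zeroI) (metis t_def B_k12 B_sym br_k2 in_k1 in_k2)
  show "N E2 E2 Ep = 0"
    by (rule N_zeroI) (metis t_def B_pk B_sym br_kk in_k(2) in_p)
  show "N E1 E2 Ep = 0"
    by (rule N_zeroI) (simp add: t_def br_k12 in_k1 in_k2 B_simps)
  show "N Ep Ep Ep = 0"
    by (rule N_zeroI) (metis t_def B_pk B_sym br_pp in_p)
qed

lemma N_zero':
  "N E1 E2 E1 = 0" "N E2 E1 E1 = 0" "N E1 Ep E1 = 0" "N Ep E1 E1 = 0"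
  "N E2 E1 E2 = 0" "N E1 E2 E2 = 0" "N E2 Ep E2 = 0" "N Ep E2 E2 = 0"
  "N E2 E1 Ep = 0" "N E1 Ep E2 = 0" "N E2 Ep E1 = 0" "N Ep E1 E2 = 0" "N Ep E2 E1 = 0"
  using N_zero N_rotate N_swap by metis+

lemma N_perm: "N Ep E1 Ep = N E1 Ep Ep" "N Ep Ep E1 = N E1 Ep Ep"
  "N Ep E2 Ep = N E2 Ep Ep" "N Ep Ep E2 = N E2 Ep Ep"
  using N_rotate N_swap by metis+

lemma sum_t_sq:
  assumes "orthofam B \<epsilon> X id" "br e f \<in> span X"
  shows "B (br e f) (br e f) = \<epsilon> * (\<Sum>g\<in>X. (t e f g)^2)"
proof -
  have "B (br e f) (br e f) = (\<Sum>g\<in>X. \<epsilon> * B (br e f) g * B g (br e f))"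
    using orthofam_parseval[OF assms(1), of "br e f" "br e f"] assms(2) by simp
  also have "\<dots> = \<epsilon> * (\<Sum>g\<in>X. (t e f g)^2)"
    unfolding sum_distrib_left
  proof (rule sum.cong[OF refl])
    fix g
    show "\<epsilon> * B (br e f) g * B g (br e f) = \<epsilon> * (t e f g)^2"
      unfolding t_def B_sym[of g "br e f"] by (simp add: power2_eq_square)
  qed
  finally show ?thesis .
qed

lemma B_br_br: "B (br e (br e f)) f = - B (br e f) (br e f)"
  by (rule B_skew)

lemma killing_on_basis:
  assumes X: "orthofam B (- 1) X id" "span X = U" "\<And>x y. x \<in> U \<Longrightarrow> y \<in> U \<Longrightarrow> br x y \<in> U"
    and e: "e \<in> U"
  shows "killing_on br U e e = - (\<Sum>f\<in>X. \<Sum>g\<in>X. (t e f g)^2)"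
proof -
  have "killing_on br U e e = (\<Sum>f\<in>X. - 1 * B (br e (br e f)) f)"
    unfolding killing_on_def X(2)[symmetric]
    by (rule trace_on_orthofam[OF X(1) linear_ad_ad]) (use X e in auto)
  also have "\<dots> = - (\<Sum>f\<in>X. \<Sum>g\<in>X. (t e f g)^2)"
  proof -
    have "B (br e f) (br e f) = - (\<Sum>g\<in>X. (t e f g)^2)" if "f \<in> X" for f
      using sum_t_sq[OF X(1), of e f] X(2,3) e that span_base[of f X] by simp
    then show ?thesis by (simp add: B_br_br sum_negf)
  qed
  finally show ?thesis .
qed

lemma N_111: "N E1 E1 E1 = \<kappa>1 * card E1" and N_222: "N E2 E2 E2 = \<kappa>2 * card E2"
proof -
  have "(\<Sum>f\<in>E1. \<Sum>g\<in>E1. (t e f g)^2) = \<kappa>1" if "e \<in> E1" for e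
    using killing_on_basis[OF E1, of e] br_k1 kappa1 in_k1[OF that] B_self(2)[OF that] by simp
  then show "N E1 E1 E1 = \<kappa>1 * card E1"
    by (simp add: N_def)
  have "(\<Sum>f\<in>E2. \<Sum>g\<in>E2. (t e f g)^2) = \<kappa>2" if "e \<in> E2" for e
    using killing_on_basis[OF E2, of e] br_k2 kappa2 in_k2[OF that] B_self(3)[OF that] by simp
  then show "N E2 E2 E2 = \<kappa>2 * card E2"
    by (simp add: N_def)
qed

text \<open>For \<open>e\<close> in \<open>k\<close> the map \<open>br e\<close> preserves both
  \<open>p\<close> and \<open>k\<close>. The sign of \<open>B\<close> on \<open>f\<close> and on
  \<open>br e f\<close> is thus the same, and all contributions to the trace have one sign.\<close>

lemma B_k_self:
  assumes "e \<in> k"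
  shows "B e e = - (\<Sum>f\<in>E. \<Sum>g\<in>E. (t e f g)^2)"
proof -
  have z: "t e f g = 0" if "f \<in> Ep" "g \<in> E1 \<union> E2" for f g
    using B_pk[OF br_kp[OF assms in_p]] in_k that by (auto simp: t_def)
  have z': "t e f g = 0" if "g \<in> Ep" "f \<in> E1 \<union> E2" for f g
  proof -
    have "t e f g = - t e g f"
      by (metis t_skew t_rotate)
    then show ?thesis using z that by simp
  qed
  have k: "(\<Sum>g\<in>E1 \<union> E2. h g) = (\<Sum>g\<in>E1. h g) + (\<Sum>g\<in>E2. h g :: real)" for h
    using fin disjoint by (simp add: sum.union_disjoint)
  have p: "B (br e f) (br e f) = (\<Sum>g\<in>E. (t e f g)^2)" if "f \<in> Ep" for f
    using sum_t_sq[OF Ep(1), of e f] br_kp[OF assms in_p[OF that]] Ep(2) z that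
    by (simp add: sum_E)
  have q: "B (br e f) (br e f) = - (\<Sum>g\<in>E. (t e f g)^2)" if "f \<in> E1 \<union> E2" for f
  proof -
    have "br e f \<in> k"
      using br_kk[OF assms] in_k that by blast
    then show ?thesis
      using sum_t_sq[OF orthofam_k, of e f] span_k z' that by (simp add: sum_E k)
  qed
  have "B e e = (\<Sum>f\<in>E. B f f * B (br e (br e f)) f)"
    unfolding killing_def[of br e e] by (rule ltr_E[OF linear_ad_ad])
  also have "\<dots> = (\<Sum>f\<in>Ep. - B (br e f) (br e f)) + ((\<Sum>f\<in>E1. B (br e f) (br e f)) + (\<Sum>f\<in>E2. B (br e f) (br e f)))"
    by (simp add: sum_E B_br_br B_self)
  also have "\<dots> = - (\<Sum>f\<in>E. \<Sum>g\<in>E. (t e f g)^2)"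
    by (simp add: p q sum_E[of "\<lambda>f. \<Sum>g\<in>E. (t e f g)^2"] sum_negf)
  finally show ?thesis .
qed

lemma N_add: "(\<Sum>e\<in>X. \<Sum>f\<in>E. \<Sum>g\<in>E. (t e f g)^2)
    = N X Ep Ep + N X Ep E1 + N X Ep E2 + N X E1 Ep + N X E1 E1 + N X E1 E2
      + N X E2 Ep + N X E2 E1 + N X E2 E2"
  unfolding N_def sum_E by (simp add: sum.distrib)

text \<open>Each basis vector of \<open>k\<close> accounts for squares adding up to 1. Summed over a
  block, the share \<kappa>_i falls on the block itself, and only the pairs from \<open>p\<close>
  can supply the rest.\<close>

lemma N_1pp: "N E1 Ep Ep = (1 - \<kappa>1) * card E1" and N_2pp: "N E2 Ep Ep = (1 - \<kappa>2) * card E2"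
proof -
  have *: "(\<Sum>e\<in>X. \<Sum>f\<in>E. \<Sum>g\<in>E. (t e f g)^2) = card X" if "\<And>e. e \<in> X \<Longrightarrow> e \<in> k \<and> B e e = - 1" for X
  proof -
    have "(\<Sum>f\<in>E. \<Sum>g\<in>E. (t e f g)^2) = 1" if "e \<in> X" for e
      using B_k_self[of e] \<open>\<And>e. e \<in> X \<Longrightarrow> e \<in> k \<and> B e e = - 1\<close>[OF that] by simp
    then show ?thesis by simp
  qed
  have "(\<Sum>e\<in>E1. \<Sum>f\<in>E. \<Sum>g\<in>E. (t e f g)^2) = card E1"
    "(\<Sum>e\<in>E2. \<Sum>f\<in>E. \<Sum>g\<in>E. (t e f g)^2) = card E2"
    by (rule *; simp add: in_k B_self)+
  then show "N E1 Ep Ep = (1 - \<kappa>1) * card E1" "N E2 Ep Ep = (1 - \<kappa>2) * card E2"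
    by (simp_all add: N_add N_zero N_zero' N_111 N_222 algebra_simps)
qed

lemma card_pos: "card Ep > 0" "card E1 > 0" "card E2 > 0"
  using fin Ep(2) E1(2) E2(2) p_nonzero k1_nonzero k2_nonzero by (auto simp: card_gt_0_iff)

text \<open>A sum of squares gives the weak inequality. Equality would make a basis vector of
  \<open>k2\<close> commute with \<open>p\<close>, which faithfulness forbids. This is the
  positivity of the leading coefficient \<open>a\<close>.\<close>

lemma kappa2_less: "\<kappa>2 < 1"
proof -
  have nn: "N E2 Ep Ep \<ge> 0"
    unfolding N_def by (intro sum_nonneg) simp
  have "N E2 Ep Ep \<noteq> 0"
  proof
    assume 0: "N E2 Ep Ep = 0"
    obtain e where e: "e \<in> E2"
      using card_pos(3) by (metis card.empty all_not_in_conv less_irrefl)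
    have t0: "t e f g = 0" if "f \<in> Ep" "g \<in> Ep" for f g
    proof -
      have "\<forall>e\<in>E2. (\<Sum>f\<in>Ep. \<Sum>g\<in>Ep. (t e f g)^2) = 0"
        using 0 unfolding N_def using fin by (subst (asm) sum_nonneg_eq_0_iff) (auto intro!: sum_nonneg)
      then have "\<forall>f\<in>Ep. (\<Sum>g\<in>Ep. (t e f g)^2) = 0"
        using e fin by (subst (asm) sum_nonneg_eq_0_iff) (auto intro!: sum_nonneg)
      then show ?thesis
        using that fin by (auto simp: sum_nonneg_eq_0_iff)
    qed
    have ef: "br e f = 0" if "f \<in> Ep" for f
    proof -
      have "br e f = (\<Sum>g\<in>Ep. (1 * B (br e f) g) *\<^sub>R g)"
        using orthofam_expand[OF Ep(1), of "br e f"] br_kp[OF in_k(2)[OF e] in_p[OF that]] Ep(2) by simp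
      then show ?thesis
        using t0[OF that] by (simp add: t_def)
    qed
    have "br e y = 0" if "y \<in> p" for y
      using linear_eq_0_on_span[OF linear_ad[of e], of Ep y] ef that Ep(2) by blast
    then have "e = 0"
      using faithful[OF in_k(2)[OF e]] by blast
    then show False
      using B_self(3)[OF e] by (simp add: B_simps)
  qed
  then have "N E2 Ep Ep > 0"
    using nn by simp
  then have "(1 - \<kappa>2) * card E2 > 0"
    by (simp only: N_2pp)
  then show ?thesis
    by (simp add: zero_less_mult_iff)
qed

section \<open>Trace and scalar curvature of the three-parameter family\<close>

definition weight where
  "weight x y z e = (if e \<in> Ep then x else if e \<in> E1 then y else (z::real))"

lemma weight:
  "e \<in> Ep \<Longrightarrow> weight x y z e = x" "e \<in> E1 \<Longrightarrow> weight x y z e = y" "e \<in> E2 \<Longrightarrow> weight x y z e = z"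
  using disjoint by (auto simp: weight_def)

lemma diag_form_weight:
  "diag_form (weight x y z) u v = x * restr Q p u v + y * restr Q k1 u v + z * restr Q k2 u v"
  unfolding diag_form_def sum_E restr_Q by (simp add: weight sum_distrib_left)

lemma weight_pos: "x > 0 \<Longrightarrow> y > 0 \<Longrightarrow> z > 0 \<Longrightarrow> weight x y z e > 0"
  by (simp add: weight_def)

lemma nr_metric_eq: "nr_metric br k p k1 k2 (x, y, z) = diag_form (weight x y z)"
  by (intro ext) (simp add: nr_metric_def diag_form_weight)

lemma dims: "dim p = card Ep" "dim k1 = card E1" "dim k2 = card E2"
  using orthofam_independent[OF Ep(1)] orthofam_independent[OF E1(1)] orthofam_independent[OF E2(1)]
    Ep(2) E1(2) E2(2) by (metis dim_span_eq_card_independent)+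

lemma metric_trace_nr:
  assumes "x > 0" "y > 0" "z > 0"
  shows "metric_trace (nr_metric br k p k1 k2 (x, y, z))
      (\<lambda>u v. - Tp * restr Q p u v + T1 * restr Q k1 u v + T2 * restr Q k2 u v)
    = - real (dim p) * Tp / x + real (dim k1) * T1 / y + real (dim k2) * T2 / z"
proof -
  have T: "(\<lambda>u v. - Tp * restr Q p u v + T1 * restr Q k1 u v + T2 * restr Q k2 u v)
      = diag_form (weight (- Tp) T1 T2)"
    by (intro ext) (simp add: diag_form_weight)
  show ?thesis
    unfolding T nr_metric_eq metric_trace_diag_form[OF weight_pos[OF assms]] sum_E dims
    by (simp add: weight)
qed

lemma scal_nr:
  assumes pos: "x > 0" "y > 0" "z > 0"
  shows "scal br (nr_metric br k p k1 k2 (x, y, z)) = - real (dim p) / (2 * x)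
      + (real (dim k1) * \<kappa>1 / (4 * y) - real (dim k1) * (1 - \<kappa>1) * y / (4 * x^2))
      + (real (dim k2) * \<kappa>2 / (4 * z) - real (dim k2) * (1 - \<kappa>2) * z / (4 * x^2))"
proof -
  let ?\<mu> = "weight x y z"
  \<comment> \<open>Constants attached to whole blocks; this is well defined because the blocks are
    nonempty and disjoint, hence different sets.\<close>
  define c where "c X = (if X = Ep then x else if X = E1 then y else z)" for X
  have "Ep \<noteq> E1" "Ep \<noteq> E2" "E1 \<noteq> E2"
    using disjoint card_pos by auto
  then have c: "c Ep = x" "c E1 = y" "c E2 = z"
    by (simp_all add: c_def)
  have \<mu>: "?\<mu> e = c X" if "X \<in> {Ep, E1, E2}" "e \<in> X" for X e
    using that c by (auto simp: weight)
  have W: "(\<Sum>e\<in>X. \<Sum>f\<in>Y. \<Sum>g\<in>Z. ?\<mu> g / (?\<mu> e * ?\<mu> f) * (t e f g)^2) = c Z / (c X * c Y) * N X Y Z"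
    if "X \<in> {Ep, E1, E2}" "Y \<in> {Ep, E1, E2}" "Z \<in> {Ep, E1, E2}" for X Y Z
    unfolding N_def sum_distrib_left
    by (intro sum.cong refl) (simp only: \<mu>[OF that(1)] \<mu>[OF that(2)] \<mu>[OF that(3)])
  have S: "(\<Sum>e\<in>E. \<Sum>f\<in>E. \<Sum>g\<in>E. ?\<mu> g / (?\<mu> e * ?\<mu> f) * (t e f g)^2)
      = y / (y * y) * N E1 E1 E1 + z / (z * z) * N E2 E2 E2
        + (x / (y * x) + x / (x * y) + y / (x * x)) * N E1 Ep Ep
        + (x / (z * x) + x / (x * z) + z / (x * x)) * N E2 Ep Ep"
    unfolding sum_E sum.distrib
    by (simp only: W insert_iff simp_thms c N_zero N_zero' N_perm mult_zero_right)
       (simp only: add_0_left add_0_right distrib_left distrib_right ac_simps)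
  have K: "(\<Sum>e\<in>E. B e e / ?\<mu> e) = card Ep / x - card E1 / y - card E2 / z"
    by (simp add: sum_E weight B_self)
  \<comment> \<open>For each i the Killing term and the two symbols of weight
    \<open>1 / \<alpha>_i\<close> combine: 1/2 - \<kappa>_i/4 - (1 - \<kappa>_i)/2 =
    \<kappa>_i/4.\<close>
  show ?thesis
    unfolding nr_metric_eq scal_diag_form[OF weight_pos[OF pos]] S K dims N_111 N_222 N_1pp N_2pp
    using pos by (simp add: field_simps power2_eq_square)
qed

end

section \<open>The isotropy algebra as a sum of ideals\<close>

lemma la_idealD:
  assumes "la_ideal br W V"
  shows "subspace V" "V \<subseteq> W" "\<And>w v. w \<in> W \<Longrightarrow> v \<in> V \<Longrightarrow> br w v \<in> V"
  using assms unfolding la_ideal_def by blast+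

lemma la_idealI:
  assumes "subspace V" "V \<subseteq> W" "\<And>w v. w \<in> W \<Longrightarrow> v \<in> V \<Longrightarrow> br w v \<in> V"
  shows "la_ideal br W V"
  using assms unfolding la_ideal_def by blast

context cartan
begin

lemma B_eq_0_k: "x \<in> k \<Longrightarrow> B x x = 0 \<Longrightarrow> x = 0"
  using B_neg[of x] by fastforce

abbreviation h where "h \<equiv> la_derived br k"

abbreviation Z where "Z \<equiv> la_centre br k"

lemma sub_h: "subspace h"
  by (simp add: la_derived_def)

lemma br_in_h: "x \<in> k \<Longrightarrow> y \<in> k \<Longrightarrow> br x y \<in> h"
  unfolding la_derived_def by (rule span_base) blast

lemma h_sub: "h \<subseteq> k"
  unfolding la_derived_def using sub_k br_kk by (intro span_minimal) auto

lemma sub_Z: "subspace Z"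
  using sub_k unfolding la_centre_def subspace_def
  by (auto simp: bilinear_lzero[OF bil_br] bilinear_ladd[OF bil_br] bilinear_lmul[OF bil_br])

lemma Z_sub: "Z \<subseteq> k" and br_Z: "z \<in> Z \<Longrightarrow> w \<in> k \<Longrightarrow> br z w = 0"
  by (auto simp: la_centre_def)

lemma B_zero_on_span:
  assumes "\<And>y. y \<in> X \<Longrightarrow> B x y = 0" "y \<in> span X"
  shows "B x y = 0"
  using linear_eq_0_on_span[OF bilinear_linear(1)[OF bil_B], of X x y] assms by blast

lemma B_Z_h: "z \<in> Z \<Longrightarrow> y \<in> h \<Longrightarrow> B z y = 0"
proof -
  assume z: "z \<in> Z" and y: "y \<in> h"
  show ?thesis
  proof (rule B_zero_on_span)
    show "y \<in> span {br u v |u v. u \<in> k \<and> v \<in> k}"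
      using y by (simp add: la_derived_def)
    show "B z y = 0" if "y \<in> {br u v |u v. u \<in> k \<and> v \<in> k}" for y
      using that br_Z[OF z] by (auto simp: B_invariant[symmetric] B_simps)
  qed
qed

lemma h_cap_Z: "x \<in> h \<Longrightarrow> x \<in> Z \<Longrightarrow> x = 0"
  using B_Z_h B_eq_0_k Z_sub by blast

text \<open>The orthogonal complement of the derived algebra in \<open>k\<close> is central:
  invariance moves the bracket to the other side, where it lies in \<open>h\<close>.\<close>

lemma k_split: "x \<in> k \<Longrightarrow> \<exists>u\<in>h. \<exists>z\<in>Z. x = u + z"
proof -
  assume x: "x \<in> k"
  obtain u where u: "u \<in> h" "\<And>w. w \<in> h \<Longrightarrow> B (x - u) w = 0"
    using k_orth_split[OF sub_h h_sub] by blast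
  have uk: "x - u \<in> k"
    using x u(1) h_sub subspace_diff[OF sub_k] by blast
  have "br (x - u) y = 0" if y: "y \<in> k" for y
  proof -
    have "B (br (x - u) y) z = 0" if "z \<in> k" for z
      using u(2)[OF br_in_h[OF y that]] by (simp add: B_invariant)
    then show ?thesis
      using B_eq_0_k br_kk[OF uk y] by blast
  qed
  then have "x - u \<in> Z"
    using uk by (simp add: la_centre_def)
  then show ?thesis
    using u(1) by (intro bexI[of _ u] bexI[of _ "x - u"]) auto
qed

text \<open>Invariance makes the complement of an ideal commute with it, so that ideals of ideals
  are ideals; this makes minimal ideals simple.\<close>

lemma ideal_orth_commute:
  assumes "la_ideal br h V" "w \<in> h" "\<And>u. u \<in> V \<Longrightarrow> B w u = 0" "v \<in> V"
  shows "br w v = 0"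
proof -
  note V = la_idealD[OF assms(1)]
  have "br w v \<in> V"
    using V(3) assms by blast
  moreover have "br v (br w v) \<in> V"
    using V(2,3) calculation assms(4) by blast
  ultimately have "B (br w v) (br w v) = 0"
    using assms(3) by (simp add: B_invariant)
  then show ?thesis
    using B_eq_0_k \<open>br w v \<in> V\<close> V(2) h_sub by blast
qed

text \<open>An element of an abelian ideal commutes with \<open>h\<close> and then with
  \<open>k\<close>, each time because invariance makes the bracket orthogonal to itself. It would be
  central, but \<open>h\<close> meets the centre only in 0.\<close>

lemma ideal_nonabelian:
  assumes V: "la_ideal br h V" "V \<noteq> {0}"
  shows "\<exists>x\<in>V. \<exists>y\<in>V. br x y \<noteq> 0"
proof (rule ccontr)
  note V' = la_idealD[OF V(1)]
  assume "\<not> ?thesis"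
  then have ab: "br x y = 0" if "x \<in> V" "y \<in> V" for x y
    using that by blast
  obtain x where x: "x \<in> V" "x \<noteq> 0"
    using V(2) subspace_0[OF V'(1)] by blast
  have xh: "br w x = 0" if w: "w \<in> h" for w
  proof -
    have "br w x \<in> V"
      using V'(3) w x by blast
    then have "B (br w x) (br w x) = 0"
      using ab[OF x(1)] by (simp add: B_invariant B_simps)
    then show ?thesis
      using B_eq_0_k \<open>br w x \<in> V\<close> V'(2) h_sub by blast
  qed
  have "br x y = 0" if y: "y \<in> k" for y
  proof -
    have xk: "x \<in> k"
      using x(1) V'(2) h_sub by blast
    have in_h: "br x y \<in> h"
      using br_in_h[OF xk y] .
    have "B (br x y) (br x y) = - B y (br x (br x y))"
      by (rule B_skew)
    moreover have "br x (br x y) = 0"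
      using xh[OF in_h] br_skew[of x "br x y"] by simp
    ultimately have "B (br x y) (br x y) = 0"
      by (simp add: B_simps)
    then show ?thesis
      using B_eq_0_k in_h h_sub by blast
  qed
  then have "x \<in> Z"
    using x(1) V'(2) h_sub by (auto simp: la_centre_def)
  then show False
    using h_cap_Z x V'(2) by blast
qed

lemma minimal_ideal_simple:
  assumes V: "la_ideal br h V" "V \<noteq> {0}"
    and min: "\<And>U. la_ideal br h U \<Longrightarrow> U \<subseteq> V \<Longrightarrow> U \<noteq> {0} \<Longrightarrow> U = V"
  shows "la_simple br V"
proof -
  note V' = la_idealD[OF V(1)]
  have "U = {0} \<or> U = V" if U: "la_ideal br V U" for U
  proof -
    note U' = la_idealD[OF U]
    have "br w x \<in> U" if w: "w \<in> h" and x: "x \<in> U" for w x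
    proof -
      \<comment> \<open>The part of \<open>w\<close> orthogonal to \<open>V\<close> commutes with
        \<open>V\<close>, so only the component in \<open>V\<close> acts on
        \<open>U\<close>.\<close>
      obtain u where u: "u \<in> V" "\<And>y. y \<in> V \<Longrightarrow> B (w - u) y = 0"
        using k_orth_split[OF V'(1)] V'(2) h_sub by blast
      have "w - u \<in> h"
        using w u(1) V'(2) subspace_diff[OF sub_h] by blast
      then have "br (w - u) x = 0"
        using ideal_orth_commute[OF V(1)] u(2) U'(2) x by blast
      then have "br w x = br u x"
        by (simp add: bilinear_lsub[OF bil_br])
      then show ?thesis
        using U'(3) u(1) x by simp
    qed
    then have "la_ideal br h U"
      using U'(1,2) V'(2) by (intro la_idealI) auto
    then show ?thesis
      using min U'(2) by blast
  qed
  moreover have "la_subalg br V"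
    using V' unfolding la_subalg_def by blast
  ultimately show ?thesis
    using ideal_nonabelian[OF V] unfolding la_simple_def by blast
qed

text \<open>A nonzero ideal of least dimension inside \<open>W\<close> is minimal.\<close>

lemma ideal_contains_simple:
  assumes "la_ideal br h W" "W \<noteq> {0}"
  obtains V where "V \<in> la_simple_ideals br k" "V \<subseteq> W"
proof -
  define P where "P V \<longleftrightarrow> la_ideal br h V \<and> V \<subseteq> W \<and> V \<noteq> {0}" for V
  have "P W"
    using assms by (simp add: P_def)
  then obtain V where V: "P V" "\<And>U. P U \<Longrightarrow> dim V \<le> dim U"
    using ex_has_least_nat[of P W dim] by blast
  have "la_simple br V"
  proof (rule minimal_ideal_simple)
    show "la_ideal br h V" "V \<noteq> {0}"
      using V(1) by (simp_all add: P_def)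
    show "U = V" if "la_ideal br h U" "U \<subseteq> V" "U \<noteq> {0}" for U
    proof -
      have "dim V \<le> dim U"
        using V that by (auto simp: P_def)
      then show ?thesis
        using subspace_dim_equal[of U V] that V(1) la_idealD(1) unfolding P_def by blast
    qed
  qed
  then show ?thesis
    using that V(1) by (auto simp: la_simple_ideals_def P_def)
qed

lemma simple_idealD:
  assumes "V \<in> la_simple_ideals br k"
  shows "la_ideal br h V" "la_simple br V" "subspace V" "V \<subseteq> h" "V \<subseteq> k" "V \<noteq> {0}"
    "\<And>x y. x \<in> V \<Longrightarrow> y \<in> V \<Longrightarrow> br x y \<in> V"
proof -
  show V: "la_ideal br h V" "la_simple br V"
    using assms by (simp_all add: la_simple_ideals_def)
  show "subspace V" "V \<subseteq> h"
    using la_idealD[OF V(1)] by blast+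
  then show "V \<subseteq> k"
    using h_sub by blast
  show "V \<noteq> {0}"
    using V(2) by (auto simp: la_simple_def)
  show "\<And>x y. x \<in> V \<Longrightarrow> y \<in> V \<Longrightarrow> br x y \<in> V"
    using V(2) by (simp add: la_simple_def la_subalg_def)
qed

text \<open>The orthogonal complement of all simple ideals is an ideal. If nonzero it would contain
  a simple ideal, which would be orthogonal to itself.\<close>

lemma h_eq_span_simple: "h = span (\<Union> (la_simple_ideals br k))"
proof
  let ?S = "\<Union> (la_simple_ideals br k)"
  show sp: "span ?S \<subseteq> h"
    using simple_idealD(4) sub_h by (intro span_minimal) auto
  define W where "W = {w \<in> h. \<forall>u\<in>?S. B w u = 0}"
  have W: "la_ideal br h W"
  proof (rule la_idealI)
    show "subspace W"
      using sub_h unfolding W_def subspace_def by (auto simp: B_simps)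
    show "W \<subseteq> h" by (auto simp: W_def)
    show "br y w \<in> W" if y: "y \<in> h" and w: "w \<in> W" for y w
    proof -
      have "br y w \<in> h"
        using br_in_h y w h_sub by (auto simp: W_def)
      moreover have "B (br y w) u = 0" if "V \<in> la_simple_ideals br k" "u \<in> V" for u V
      proof -
        have "br y u \<in> V"
          using la_idealD(3)[OF simple_idealD(1)] that y by blast
        then show ?thesis
          using w that by (auto simp: W_def B_skew[of y w])
      qed
      ultimately show ?thesis by (auto simp: W_def)
    qed
  qed
  have "W = {0}"
  proof (rule ccontr)
    assume "W \<noteq> {0}"
    then obtain V where V: "V \<in> la_simple_ideals br k" "V \<subseteq> W"
      using ideal_contains_simple[OF W] by blast
    then obtain x where x: "x \<in> V" "x \<noteq> 0"
      using simple_idealD(3,6)[OF V(1)] subspace_0 by blast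
    have "B x x = 0"
      using x V by (auto simp: W_def)
    then show False
      using B_eq_0_k x simple_idealD(5)[OF V(1)] by blast
  qed
  show "h \<subseteq> span ?S"
  proof
    fix x assume x: "x \<in> h"
    obtain u where u: "u \<in> span ?S" "\<And>w. w \<in> span ?S \<Longrightarrow> B (x - u) w = 0"
      using k_orth_split[OF subspace_span] sp h_sub by blast
    have "x - u \<in> h"
      using x u(1) sp subspace_diff[OF sub_h] by blast
    then have "x - u \<in> W"
      using u(2)[OF span_base] by (auto simp: W_def)
    then show "x \<in> span ?S"
      using \<open>W = {0}\<close> u(1) by simp
  qed
qed

text \<open>The bracket lies in the intersection, which is an ideal of both and hence zero.\<close>

lemma simple_ideals_commute:
  assumes V: "V \<in> la_simple_ideals br k" and U: "U \<in> la_simple_ideals br k" and "V \<noteq> U"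
    and x: "x \<in> V" and y: "y \<in> U"
  shows "br x y = 0"
proof -
  note V' = simple_idealD[OF V] and U' = simple_idealD[OF U]
  have I: "la_ideal br V (V \<inter> U)" "la_ideal br U (V \<inter> U)"
    using V' U' la_idealD(3)[OF V'(1)] la_idealD(3)[OF U'(1)]
    by (auto intro!: la_idealI subspace_inter)
  have "V \<inter> U = {0}"
    using V'(2) U'(2) I \<open>V \<noteq> U\<close> unfolding la_simple_def by metis
  moreover have "br x y \<in> U"
    using la_idealD(3)[OF U'(1)] x y V'(4) by blast
  moreover have "br y x \<in> V"
    using la_idealD(3)[OF V'(1)] x y U'(4) by blast
  then have "br x y \<in> V"
    using br_skew[of x y] V'(3) subspace_neg by metis
  ultimately show ?thesis by blast
qed

lemma simple_ideal_perfect: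
  assumes V: "V \<in> la_simple_ideals br k"
  shows "la_derived br V = V"
proof -
  note V' = simple_idealD[OF V]
  have sub: "la_derived br V \<subseteq> V"
    unfolding la_derived_def using V' by (intro span_minimal) auto
  have "la_ideal br V (la_derived br V)"
  proof (rule la_idealI[OF _ sub])
    show "subspace (la_derived br V)"
      by (simp add: la_derived_def)
    show "br w v \<in> la_derived br V" if "w \<in> V" "v \<in> la_derived br V" for w v
      using that sub unfolding la_derived_def by (intro span_base) blast
  qed
  moreover have "la_derived br V \<noteq> {0}"
  proof -
    obtain x y where xy: "x \<in> V" "y \<in> V" "br x y \<noteq> 0"
      using V'(2) unfolding la_simple_def by blast
    then have "br x y \<in> la_derived br V"
      unfolding la_derived_def by (intro span_base) blast
    then show ?thesis using xy by blast
  qed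
  ultimately show ?thesis
    using V'(2) unfolding la_simple_def by blast
qed

text \<open>A simple ideal is spanned by its brackets, and B([u, v], z) = B(u, [v, z]) = 0. This
  derives orthogonality of \<open>k1\<close> and \<open>k2\<close> from their commuting, in both
  cases at once.\<close>

lemma simple_ideal_orth:
  assumes V: "V \<in> la_simple_ideals br k" and z: "\<And>y. y \<in> V \<Longrightarrow> br y z = 0" and x: "x \<in> V"
  shows "B x z = 0"
proof -
  have "B z x = 0"
  proof (rule B_zero_on_span)
    show "x \<in> span {br u v |u v. u \<in> V \<and> v \<in> V}"
      using simple_ideal_perfect[OF V] x by (simp add: la_derived_def)
    show "B z y = 0" if y: "y \<in> {br u v |u v. u \<in> V \<and> v \<in> V}" for y
    proof -
      obtain u v where "u \<in> V" "v \<in> V" "y = br u v"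
        using y by blast
      then show ?thesis
        using z by (simp add: B_sym[of z] B_invariant B_simps)
    qed
  qed
  then show ?thesis by (simp add: B_sym)
qed

text \<open>The kernel of the action of \<open>k\<close> on \<open>p\<close> is an ideal of the
  whole algebra, and it is proper because \<open>p\<close> is nonzero.\<close>

lemma faithful:
  assumes simple: "la_simple br UNIV" and p: "p \<noteq> {0}"
    and x: "x \<in> k" "\<And>y. y \<in> p \<Longrightarrow> br x y = 0"
  shows "x = 0"
proof -
  define J where "J = {x \<in> k. \<forall>y\<in>p. br x y = 0}"
  have span: "\<exists>u\<in>k. \<exists>v\<in>p. w = u + v" for w
  proof -
    obtain u where u: "u \<in> k" "\<And>y. y \<in> k \<Longrightarrow> B (w - u) y = 0"
      using k_orth_split[OF sub_k order_refl] by blast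
    then have "w - u \<in> p"
      by (simp add: p_eq)
    then show ?thesis
      using u(1) by (intro bexI[of _ u] bexI[of _ "w - u"]) auto
  qed
  have "la_ideal br UNIV J"
  proof (rule la_idealI)
    show "subspace J"
      using sub_k unfolding J_def subspace_def
      by (auto simp: bilinear_lzero[OF bil_br] bilinear_ladd[OF bil_br] bilinear_lmul[OF bil_br])
    show "br w y \<in> J" if y: "y \<in> J" for w y
    proof -
      obtain u v where uv: "u \<in> k" "v \<in> p" "w = u + v"
        using span by blast
      have "br v y = 0"
        using y uv br_skew[of v y] by (simp add: J_def)
      then have "br w y = br u y"
        by (simp add: uv bilinear_ladd[OF bil_br])
      moreover have "br (br u y) z = 0" if "z \<in> p" for z
        using y br_kp[OF uv(1) that] that by (simp add: br_jacobi J_def bilinear_rzero[OF bil_br])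
      ultimately show ?thesis
        using y uv br_kk by (simp add: J_def)
    qed
  qed simp
  moreover have "J \<noteq> UNIV"
  proof
    assume "J = UNIV"
    then have "k = UNIV"
      by (auto simp: J_def)
    obtain y where y: "y \<in> p" "y \<noteq> 0"
      using p subspace_0[OF sub_p] by blast
    then have "B y y = 0"
      using B_pk \<open>k = UNIV\<close> by blast
    then show False
      using B_pos[OF y] by simp
  qed
  ultimately have "J = {0}"
    using simple unfolding la_simple_def by blast
  then show ?thesis
    using x by (auto simp: J_def)
qed

lemma cartan_splitI:
  assumes simple: "la_simple br UNIV" and p: "p \<noteq> {0}"
    and rs: "(la_simple_ideals br k = {k1, k2} \<and> k1 \<noteq> k2 \<and> Z = {0}) \<or>
       (la_simple_ideals br k = {k1} \<and> k2 = Z \<and> k2 \<noteq> {0})"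
    and kappa1: "\<forall>x\<in>k1. \<forall>y\<in>k1. killing_on br k1 x y = \<kappa>1 * B x y"
    and kappa2: "\<forall>x\<in>k2. \<forall>y\<in>k2. killing_on br k2 x y = \<kappa>2 * B x y"
  shows "cartan_split br k p k1 k2 \<kappa>1 \<kappa>2"
proof -
  have S1: "k1 \<in> la_simple_ideals br k"
    using rs by auto
  note k1 = simple_idealD[OF S1]
  have comm: "br x y = 0" if "x \<in> k1" "y \<in> k2" for x y
    using rs
  proof
    assume "la_simple_ideals br k = {k1, k2} \<and> k1 \<noteq> k2 \<and> Z = {0}"
    then show ?thesis
      using simple_ideals_commute[of k1 k2] that by auto
  next
    assume "la_simple_ideals br k = {k1} \<and> k2 = Z \<and> k2 \<noteq> {0}"
    then have "br y x = 0"
      using br_Z that k1(5) by blast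
    then show ?thesis
      using br_skew[of x y] by simp
  qed
  have k2: "subspace k2" "k2 \<noteq> {0}" "k2 \<subseteq> k" "\<And>x y. x \<in> k2 \<Longrightarrow> y \<in> k2 \<Longrightarrow> br x y \<in> k2"
    using rs simple_idealD[of k2] sub_Z Z_sub br_Z subspace_0[OF sub_Z] by (auto simp: subset_iff)
  \<comment> \<open>Starting from k = h + Z, either the centre is zero and \<open>h\<close> is the
    sum of two simple ideals, or \<open>h\<close> is \<open>k1\<close> and the centre is
    \<open>k2\<close>.\<close>
  have "\<exists>y\<in>k1. \<exists>z\<in>k2. x = y + z" if x: "x \<in> k" for x
  proof -
    obtain u z where uz: "u \<in> h" "z \<in> Z" "x = u + z"
      using k_split[OF x] by blast
    show ?thesis
      using rs
    proof
      assume *: "la_simple_ideals br k = {k1, k2} \<and> k1 \<noteq> k2 \<and> Z = {0}"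
      then have "h = span (k1 \<union> k2)"
        using h_eq_span_simple by simp
      also have "\<dots> = {x + y |x y. x \<in> k1 \<and> y \<in> k2}"
        using k1(3) k2(1) by (auto simp: span_Un span_eq_iff[THEN iffD2])
      finally have "u \<in> {x + y |x y. x \<in> k1 \<and> y \<in> k2}"
        using uz(1) by (rule subst)
      moreover have "x = u"
        using uz(2,3) * by simp
      ultimately show ?thesis
        by blast
    next
      assume *: "la_simple_ideals br k = {k1} \<and> k2 = Z \<and> k2 \<noteq> {0}"
      then have "h = k1"
        using h_eq_span_simple k1(3) by (simp add: span_eq_iff[THEN iffD2])
      then show ?thesis
        using uz * by blast
    qed
  qed
  moreover have "y + z \<in> k" if "y \<in> k1" "z \<in> k2" for y z
    using that k1(5) k2(3) by (intro subspace_add[OF sub_k]) auto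
  ultimately have k_eq: "k = {x + y |x y. x \<in> k1 \<and> y \<in> k2}"
    by fastforce
  show ?thesis
  proof unfold_locales
    show "B x y = 0" if "x \<in> k1" "y \<in> k2" for x y
      using simple_ideal_orth[OF S1] comm that by blast
    show "x = 0" if "x \<in> k" "\<And>y. y \<in> p \<Longrightarrow> br x y = 0" for x
      using faithful[OF simple p] that by blast
  qed (use k1 k2 k_eq comm p kappa1 kappa2 in auto)
qed

end

context cartan_split
begin

lemma obtain_bases:
  obtains Ep E1 E2 where "cartan_basis br k p k1 k2 \<kappa>1 \<kappa>2 Ep E1 E2"
proof -
  obtain Ep where Ep: "orthofam B 1 Ep id" "span Ep = p"
    using exists_orthofam[OF bil_B B_sym _ sub_p, of 1] B_pos by auto
  obtain E1 where E1: "orthofam B (- 1) E1 id" "span E1 = k1"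
    using obtain_k_basis[OF sub_k1 k1_sub] .
  obtain E2 where E2: "orthofam B (- 1) E2 id" "span E2 = k2"
    using obtain_k_basis[OF sub_k2 k2_sub] .
  have "cartan_basis br k p k1 k2 \<kappa>1 \<kappa>2 Ep E1 E2"
    by unfold_locales fact+
  then show ?thesis by (rule that)
qed

end

theorem theorem5p8:
  fixes br :: "'g::euclidean_space \<Rightarrow> 'g \<Rightarrow> 'g"
    and k p k1 k2 :: "'g set"
    and \<kappa>1 \<kappa>2 Tp T1 T2 :: real
    and n d1 d2 a b c d D Rt Rd Rs :: real
    and T :: "'g \<Rightarrow> 'g \<Rightarrow> real"
    and M :: "(real \<times> real \<times> real) set"
    and Sf :: "real \<times> real \<times> real \<Rightarrow> real"
  assumes lie: "lie_algebra br"
    and simple: "la_simple br UNIV"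
    and cartan: "cartan_decomp br k p"
    and noncompact: "p \<noteq> {0}"
    and r_plus_s_eq_2:
      "(la_simple_ideals br k = {k1, k2} \<and> k1 \<noteq> k2 \<and> la_centre br k = {0}) \<or>
       (la_simple_ideals br k = {k1} \<and> k2 = la_centre br k \<and> k2 \<noteq> {0})"
    and kappa1: "\<forall>x\<in>k1. \<forall>y\<in>k1. killing_on br k1 x y = \<kappa>1 * killing br x y"
    and kappa2: "\<forall>x\<in>k2. \<forall>y\<in>k2. killing_on br k2 x y = \<kappa>2 * killing br x y"
    and Tp_pos: "Tp > 0" and T1_pos: "T1 > 0" and T2_pos: "T2 > 0"
    and "n = real (dim p)" and "d1 = real (dim k1)" and "d2 = real (dim k2)"
    and "T = (\<lambda>x y. - Tp * restr (Qform br k p) p x y + T1 * restr (Qform br k p) k1 x y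
                    + T2 * restr (Qform br k p) k2 x y)"
    and "M = {m. fst m > 0 \<and> fst (snd m) > 0 \<and> snd (snd m) > 0 \<and>
                 metric_trace (nr_metric br k p k1 k2 m) T = 0}"
    and "Sf = (\<lambda>m. scal br (nr_metric br k p k1 k2 m))"
    and "a = n * d2 * (1 - \<kappa>2) * Tp"
    and "b = d1^2 * (1 - \<kappa>1) * T1 - d2^2 * (1 - \<kappa>2) * T2 + 2 * n^2 * Tp
             - n^2 * \<kappa>1 * Tp^2 / T1"
    and "c = - 2 * n * d2 * T2 + 2 * n * d2 * \<kappa>1 * Tp * T2 / T1 - n * d2 * \<kappa>2 * Tp"
    and "d = \<kappa>2 * d2^2 * T2 - d2^2 * \<kappa>1 * T2^2 / T1"
    and "D = 18 * a * b * c * d - 4 * b^3 * d + b^2 * c^2 - 4 * a * c^3 - 27 * a^2 * d^2"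
    and "Rt = - b / (3 * a)"
    and "Rd = (9 * a * d - b * c) / (2 * (b^2 - 3 * a * c))"
    and "Rs = (4 * a * b * c - 9 * a^2 * d - b^3) / (a * (b^2 - 3 * a * c))"
  shows "\<not> (\<exists>m. is_global_min Sf M m)
    \<and> ((\<exists>m. is_saddle Sf M m) \<longleftrightarrow>
         D = 0 \<and> b^2 = 3 * a * c \<and> d2 * T2 / (n * Tp) < Rt)
    \<and> ((\<exists>m. is_global_max Sf M m) \<longleftrightarrow>
         D = 0 \<and> b^2 \<noteq> 3 * a * c \<and> Rs \<le> d2 * T2 / (n * Tp) \<and> d2 * T2 / (n * Tp) < Rd)
    \<and> ((\<exists>m. is_local_max Sf M m \<and> \<not> is_global_max Sf M m) \<longleftrightarrow>
         D = 0 \<and> b^2 \<noteq> 3 * a * c \<and> d2 * T2 / (n * Tp) < Rs \<and> Rs < Rd)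
    \<and> ((\<exists>m. is_local_min Sf M m) \<longleftrightarrow>
         D = 0 \<and> b^2 \<noteq> 3 * a * c \<and> d2 * T2 / (n * Tp) < Rd \<and> Rd < Rs)
    \<and> (\<forall>m m'. is_critical Sf M m \<and> is_critical Sf M m' \<longrightarrow> (\<exists>t>0. m' = t *\<^sub>R m))"
proof -
  interpret cartan br k p
    by unfold_locales (fact lie cartan)+
  interpret cartan_split br k p k1 k2 \<kappa>1 \<kappa>2
    by (rule cartan_splitI[OF simple noncompact r_plus_s_eq_2 kappa1 kappa2])
  obtain Ep E1 E2 where "cartan_basis br k p k1 k2 \<kappa>1 \<kappa>2 Ep E1 E2"
    using obtain_bases .
  then interpret cb: cartan_basis br k p k1 k2 \<kappa>1 \<kappa>2 Ep E1 E2 .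
  note dim_eqs = assms(11-13) and T_eq = assms(14) and M_eq = assms(15) and Sf_eq = assms(16)
  \<comment> \<open>The auxiliary bases disappear here: trace and curvature depend only on the
    dimensions, the \<kappa>_i and the parameters.\<close>
  interpret tz: trace_zero_cone n d1 d2 \<kappa>1 \<kappa>2 Tp T1 T2 M Sf
  proof
    show "n > 0" "d1 > 0" "d2 > 0"
      using cb.card_pos by (simp_all add: dim_eqs cb.dims)
    show "\<kappa>2 < 1"
      by (rule cb.kappa2_less)
    show "Tp > 0" "T1 > 0" "T2 > 0"
      by fact+
    show "(x, y, z) \<in> M \<longleftrightarrow>
          x > 0 \<and> y > 0 \<and> z > 0 \<and> - n * Tp / x + d1 * T1 / y + d2 * T2 / z = 0" for x y z
    proof (cases "x > 0 \<and> y > 0 \<and> z > 0")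
      case True
      then have "metric_trace (nr_metric br k p k1 k2 (x, y, z)) T
          = - n * Tp / x + d1 * T1 / y + d2 * T2 / z"
        unfolding T_eq dim_eqs using cb.metric_trace_nr[of x y z Tp T1 T2] by blast
      then show ?thesis
        by (simp add: M_eq)
    qed (auto simp: M_eq)
    show "Sf (x, y, z) = - n / (2 * x) + (d1 * \<kappa>1 / (4 * y) - d1 * (1 - \<kappa>1) * y / (4 * x^2))
            + (d2 * \<kappa>2 / (4 * z) - d2 * (1 - \<kappa>2) * z / (4 * x^2))"
      if "x > 0" "y > 0" "z > 0" for x y z
      unfolding Sf_eq dim_eqs by (rule cb.scal_nr[OF that])
  qed
  have "tz.a = a" "tz.b = b" "tz.c = c" "tz.d = d"
    unfolding tz.a_def tz.b_def tz.c_def tz.d_def assms(17-20) by (rule refl)+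
  note points = tz.critical_points[unfolded this tz.r0_def]
  show ?thesis
    unfolding assms(21-24)
    using tz.no_global_min points by (intro conjI allI impI) blast+
qed

end
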